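(* For $n\geq 3$, any representation of the $n$-qubit Clifford group $\mathcal{C}_n$ which is non-trivial on the $n$-qubit Pauli group $\mathcal{P}_n$ (i.e. some element of $\mathcal{P}_n$ does not act as the identity) is faithful. In particular, the matrix representation $\mathcal{M}_{2^n}$ of $\mathcal{C}_n$ is faithful for all $n\geq 1$.
   Context: Let $I_2$ be the $2\times 2$ identity matrix, $X=\begin{pmatrix}0&1\\1&0\end{pmatrix}$, $Y=\begin{pmatrix}0&-i\\ i&0\end{pmatrix}$, $Z=\begin{pmatrix}1&0\\0&-1\end{pmatrix}$. Let $\hat{\mathcal{P}}_n=\{\sigma_1\otimes\cdots\otimes\sigma_n : \sigma_k\in\{I_2,X,Y,Z\}\}$, a set of unitary $2^n\times 2^n$ complex matrices, and let $\langle\hat{\mathcal{P}}_n\rangle$ be the subgroup of the unitary group $U(2^n)$ that it generates. The $n$-qubit Clifford group $\mathcal{C}_n$ is the group of all $A\in U(2^n)$ such that $A\sigma A^{-1}\in\langle\hat{\mathcal{P}}_n\rangle$ for all $\sigma\in\langle\hat{\mathcal{P}}_n\rangle$, modulo the subgroup of scalar unitary matrices (the global phase). It is a finite group of order $2^{n^2+2n}\prod_{j=1}^n(2^{2j}-1)$. The $n$-qubit Pauli group $\mathcal{P}_n$ is $\langle\hat{\mathcal{P}}_n\rangle$ modulo its center $\{c I_2^{\otimes n}: c\in\{\pm1,\pm i\}\}$, identified with the image of $\langle\hat{\mathcal{P}}_n\rangle$ in $\mathcal{C}_n$. Representations are over $\mathbb{C}$. The matrix representation $\mathcal{M}_{2^n}$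 is the complex vector space of all $2^n\times 2^n$ complex matrices, identified with $(\mathcal{M}_2)^{\otimes n}$ where $\mathcal{M}_2$ is the space of $2\times 2$ complex matrices, on which $\mathcal{C}_n$ acts by conjugation $A\cdot M:=AMA^{-1}$ (well defined since scalars act trivially). *)

theory Defs
  imports
    "Jordan_Normal_Form.Schur_Decomposition"
    "HOL-Algebra.Group_Action"
    "HOL-Algebra.Generated_Groups"
begin

section \<open>Pauli strings\<close>

definition pauli_X :: "complex mat" where
  "pauli_X = mat_of_rows_list 2 [[0, 1], [1, 0]]"

definition pauli_Y :: "complex mat" where
  "pauli_Y = mat_of_rows_list 2 [[0, - \<i>], [\<i>, 0]]"

definition pauli_Z :: "complex mat" where
  "pauli_Z = mat_of_rows_list 2 [[1, 0], [0, - 1]]"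

text \<open>Kronecker product: entry \<open>(i\<^sub>1 * r + i\<^sub>2, j\<^sub>1 * c + j\<^sub>2)\<close> is
  \<open>A (i\<^sub>1, j\<^sub>1) * B (i\<^sub>2, j\<^sub>2)\<close>, where \<open>B\<close> is an \<open>r\<close> by \<open>c\<close> matrix.\<close>

definition kron :: "complex mat \<Rightarrow> complex mat \<Rightarrow> complex mat" where
  "kron A B = mat (dim_row A * dim_row B) (dim_col A * dim_col B)
     (\<lambda>(i, j). A $$ (i div dim_row B, j div dim_col B) * B $$ (i mod dim_row B, j mod dim_col B))"

definition pauli_strings :: "nat \<Rightarrow> complex mat set" where
  "pauli_strings n = {foldr kron \<sigma>s (1\<^sub>m 1) | \<sigma>s.
     length \<sigma>s = n \<and> set \<sigma>s \<subseteq> {1\<^sub>m 2, pauli_X, pauli_Y, pauli_Z}}"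

section \<open>The unitary, Pauli and Clifford groups\<close>

definition unitary_group :: "nat \<Rightarrow> complex mat monoid" where
  "unitary_group d =
     \<lparr>carrier = {A \<in> carrier_mat d d. A * mat_adjoint A = 1\<^sub>m d \<and> mat_adjoint A * A = 1\<^sub>m d},
      monoid.mult = (*), one = 1\<^sub>m d\<rparr>"

definition pauli_unitaries :: "nat \<Rightarrow> complex mat set" where
  "pauli_unitaries n = generate (unitary_group (2 ^ n)) (pauli_strings n)"

definition clifford_unitaries :: "nat \<Rightarrow> complex mat monoid" where
  "clifford_unitaries n = (unitary_group (2 ^ n))
     \<lparr>carrier := {A \<in> carrier (unitary_group (2 ^ n)). \<forall>\<sigma> \<in> pauli_unitaries n.
        A * \<sigma> * inv\<^bsub>unitary_group (2 ^ n)\<^esub> A \<in> pauli_unitaries n}\<rparr>"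

definition scalar_unitaries :: "nat \<Rightarrow> complex mat set" where
  "scalar_unitaries n = {A \<in> carrier (unitary_group (2 ^ n)). \<exists>c. A = c \<cdot>\<^sub>m 1\<^sub>m (2 ^ n)}"

text \<open>Elements of the Clifford group are cosets of the global phases.\<close>

definition clifford_group :: "nat \<Rightarrow> complex mat set monoid" where
  "clifford_group n = clifford_unitaries n Mod scalar_unitaries n"

text \<open>The Pauli group, as the image in the Clifford group of the group generated by the
  Pauli strings.\<close>

definition pauli_group :: "nat \<Rightarrow> complex mat set set" where
  "pauli_group n = (\<lambda>A. scalar_unitaries n #>\<^bsub>clifford_unitaries n\<^esub> A) ` pauli_unitaries n"

section \<open>Complex representations\<close>

text \<open>No restriction on the dimension is imposed. The functions \<open>\<rho> g\<close> are extensional on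
  \<open>carrier V\<close> (they are elements of \<^term>\<open>BijGroup (carrier V)\<close>), so \<^locale>\<open>faithful_action\<close>
  says that distinct group elements act by distinct linear automorphisms of \<open>V\<close>.\<close>

locale representation =
  vectorspace "class_ring :: complex ring" V + group_action G "carrier V" \<rho>
  for G :: "('g, 'm) monoid_scheme" and V :: "(complex, 'v) module" and \<rho> :: "'g \<Rightarrow> 'v \<Rightarrow> 'v" +
  assumes linear: "g \<in> carrier G \<Longrightarrow> linear_map (class_ring :: complex ring) V V (\<rho> g)"

abbreviation matrix_space :: "nat \<Rightarrow> (complex, complex mat) module" where
  "matrix_space n \<equiv> module_mat TYPE(complex) (2 ^ n) (2 ^ n)"

text \<open>Conjugation by a coset \<open>C\<close> of unitaries; by \<open>conj_action_coset\<close> below the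
  argument of \<^const>\<open>the_elem\<close> is a singleton, i.e. the choice of representative is irrelevant.\<close>

definition conj_action :: "nat \<Rightarrow> complex mat set \<Rightarrow> complex mat \<Rightarrow> complex mat" where
  "conj_action n C = (\<lambda>M \<in> carrier (matrix_space n).
     the_elem ((\<lambda>A. A * M * inv\<^bsub>unitary_group (2 ^ n)\<^esub> A) ` C))"

lemma mat_adjoint_dims [simp]:
  "dim_row (mat_adjoint A) = dim_col A" "dim_col (mat_adjoint A) = dim_row A"
  by (auto simp: mat_adjoint_def)

lemma mat_adjoint_carrier [simp]:
  "A \<in> carrier_mat m n \<Longrightarrow> mat_adjoint A \<in> carrier_mat n m"
  by (metis carrier_matD carrier_matI mat_adjoint_dims)

lemma mat_adjoint_index:
  fixes A :: "complex mat"
  shows "i < dim_col A \<Longrightarrow> j < dim_row A \<Longrightarrow> mat_adjoint A $$ (i, j) = cnj (A $$ (j, i))"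
  by (simp add: mat_adjoint_def mat_of_rows_def)

lemma mat_adjoint_adjoint: "mat_adjoint (mat_adjoint A) = (A :: complex mat)"
  by (rule eq_matI) (auto simp: mat_adjoint_index)

lemma mat_adjoint_mult:
  fixes A B :: "complex mat"
  assumes "A \<in> carrier_mat m n" "B \<in> carrier_mat n k"
  shows "mat_adjoint (A * B) = mat_adjoint B * mat_adjoint A"
proof (rule eq_matI)
  fix i j assume "i < dim_row (mat_adjoint B * mat_adjoint A)" "j < dim_col (mat_adjoint B * mat_adjoint A)"
  then show "mat_adjoint (A * B) $$ (i, j) = (mat_adjoint B * mat_adjoint A) $$ (i, j)"
    using assms by (simp add: mat_adjoint_index scalar_prod_def) (simp add: mult.commute)
qed (use assms in simp_all)

lemma mat_adjoint_one: "mat_adjoint (1\<^sub>m n :: complex mat) = 1\<^sub>m n"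
  by (rule eq_matI) (auto simp: mat_adjoint_index)

lemma mat_adjoint_smult: "mat_adjoint (c \<cdot>\<^sub>m A) = cnj c \<cdot>\<^sub>m mat_adjoint (A :: complex mat)"
  by (rule eq_matI) (auto simp: mat_adjoint_index)

lemma smult_smult_mat_mult: "a \<cdot>\<^sub>m (b \<cdot>\<^sub>m A) = (a * b) \<cdot>\<^sub>m (A :: complex mat)"
  by (rule eq_matI) auto

lemma one_smult_mat: "1 \<cdot>\<^sub>m A = (A :: complex mat)"
  by (rule eq_matI) auto

lemma unitary_mult_cancel:
  fixes A B :: "complex mat"
  assumes "A \<in> carrier_mat d d" "B \<in> carrier_mat d d" "A' \<in> carrier_mat d d" "B' \<in> carrier_mat d d"
    and "A * A' = 1\<^sub>m d" "B * B' = 1\<^sub>m d"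
  shows "(A * B) * (B' * A') = 1\<^sub>m d"
proof -
  have "(A * B) * (B' * A') = A * (B * B') * A'"
    using assoc_mult_mat[of "A * B" d d B' d A' d] assoc_mult_mat[of A d d B d B' d] assms(1-4)
    by (metis mult_carrier_mat)
  also have "\<dots> = 1\<^sub>m d"
    using assms(1) by (simp only: assms(5,6) right_mult_one_mat)
  finally show ?thesis .
qed

lemma group_unitary_group: "group (unitary_group d)"
proof (rule groupI)
  fix A B assume AB: "A \<in> carrier (unitary_group d)" "B \<in> carrier (unitary_group d)"
  then show "A \<otimes>\<^bsub>unitary_group d\<^esub> B \<in> carrier (unitary_group d)"
    by (simp add: unitary_group_def mat_adjoint_mult[of A d d B d] mult_carrier_mat[of A d d B d]
        unitary_mult_cancel[of A d B "mat_adjoint A" "mat_adjoint B"]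
        unitary_mult_cancel[of "mat_adjoint B" d "mat_adjoint A" B A])
next
  fix A assume "A \<in> carrier (unitary_group d)"
  then show "\<exists>B \<in> carrier (unitary_group d). B \<otimes>\<^bsub>unitary_group d\<^esub> A = \<one>\<^bsub>unitary_group d\<^esub>"
    by (intro bexI[of _ "mat_adjoint A"]) (auto simp: unitary_group_def mat_adjoint_adjoint)
next
  fix A B C
  assume "A \<in> carrier (unitary_group d)" "B \<in> carrier (unitary_group d)"
    "C \<in> carrier (unitary_group d)"
  then show "A \<otimes>\<^bsub>unitary_group d\<^esub> B \<otimes>\<^bsub>unitary_group d\<^esub> C
      = A \<otimes>\<^bsub>unitary_group d\<^esub> (B \<otimes>\<^bsub>unitary_group d\<^esub> C)"
    using assoc_mult_mat[of A d d B d C d] by (simp add: unitary_group_def)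
qed (simp_all add: unitary_group_def mat_adjoint_one left_mult_one_mat[of _ d d])

lemma inv_unitary_group:
  assumes "A \<in> carrier (unitary_group d)"
  shows "inv\<^bsub>unitary_group d\<^esub> A = mat_adjoint A"
  using assms by (intro group.inv_equality[OF group_unitary_group])
    (auto simp: unitary_group_def mat_adjoint_adjoint)

lemma conj_action_coset:
  assumes A: "A \<in> carrier (clifford_unitaries n)" and M: "M \<in> carrier_mat (2 ^ n) (2 ^ n)"
  shows "conj_action n (scalar_unitaries n #>\<^bsub>clifford_unitaries n\<^esub> A) M
    = A * M * inv\<^bsub>unitary_group (2 ^ n)\<^esub> A"
proof -
  let ?d = "2 ^ n :: nat" and ?U = "unitary_group (2 ^ n)"
  have AU: "A \<in> carrier ?U" using A by (simp add: clifford_unitaries_def)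
  then have Ac: "A \<in> carrier_mat ?d ?d" by (simp add: unitary_group_def)
  have conj: "S * A * M * inv\<^bsub>?U\<^esub> (S * A) = A * M * inv\<^bsub>?U\<^esub> A" if S: "S \<in> scalar_unitaries n" for S
  proof -
    from S obtain c where SU: "S \<in> carrier ?U" and Sc: "S = c \<cdot>\<^sub>m 1\<^sub>m ?d"
      by (auto simp: scalar_unitaries_def)
    have "c * cnj c = 1"
    proof -
      have "(S * mat_adjoint S) $$ (0, 0) = (1\<^sub>m ?d :: complex mat) $$ (0, 0)"
        using SU by (simp add: unitary_group_def)
      then show ?thesis
        by (simp add: Sc mat_adjoint_smult mat_adjoint_one
            smult_smult_mat_mult mult_smult_assoc_mat[of _ ?d ?d _ ?d] mult_smult_distrib[of _ ?d ?d _ ?d]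
            mult.commute[of "cnj c"])
    qed
    have SA: "S * A = c \<cdot>\<^sub>m A" using Ac by (simp add: Sc mult_smult_assoc_mat[of _ ?d ?d _ ?d])
    have "S * A \<in> carrier ?U"
      using group.is_monoid[OF group_unitary_group, THEN monoid.m_closed, OF SU AU]
      by (simp add: unitary_group_def)
    then have "inv\<^bsub>?U\<^esub> (S * A) = cnj c \<cdot>\<^sub>m mat_adjoint A"
      by (simp add: inv_unitary_group SA mat_adjoint_smult)
    then have "S * A * M * inv\<^bsub>?U\<^esub> (S * A) = (c * cnj c) \<cdot>\<^sub>m (A * M * mat_adjoint A)"
      using Ac M by (simp add: SA mult_smult_assoc_mat[of _ ?d ?d _ ?d]
          mult_smult_distrib[of _ ?d ?d _ ?d] smult_smult_mat_mult mult.commute)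
    also have "\<dots> = A * M * inv\<^bsub>?U\<^esub> A"
      using Ac M \<open>c * cnj c = 1\<close> by (simp add: inv_unitary_group[OF AU] one_smult_mat)
    finally show ?thesis .
  qed
  have one: "1\<^sub>m ?d \<in> scalar_unitaries n"
    using group.is_monoid[OF group_unitary_group, THEN monoid.one_closed, of ?d]
    by (auto simp: scalar_unitaries_def unitary_group_def one_smult_mat intro!: exI[of _ 1])
  have "(\<lambda>B. B * M * inv\<^bsub>?U\<^esub> B) ` (scalar_unitaries n #>\<^bsub>clifford_unitaries n\<^esub> A)
      = (\<lambda>S. S * A * M * inv\<^bsub>?U\<^esub> (S * A)) ` scalar_unitaries n"
    by (auto simp: r_coset_def clifford_unitaries_def unitary_group_def)
  also have "\<dots> = {A * M * inv\<^bsub>?U\<^esub> A}" using one conj by auto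
  finally show ?thesis using M by (simp add: conj_action_def module_mat_simps)
qed

end

theory Submission
  imports Defs
begin

text \<open>The kernel of a representation of the Clifford group pulls back to a normal subgroup \<open>N\<close> of the
group of Clifford unitaries that contains all global phases. The whole result rests on a
dichotomy for such subgroups (\<open>clifford_normal_subgroup_dichotomy\<close>): either \<open>N\<close> consists of scalar
matrices, and the representation is faithful, or \<open>N\<close> contains every Pauli unitary, and the
representation is trivial on the Pauli group.

Suppose \<open>N\<close> contains a non-scalar \<open>A\<close>. The first step is to find a non-scalar Pauli string
in \<open>N\<close>. If \<open>A\<close> fails to commute up to sign with some string \<open>\<tau>\<close>, then the commutator
of \<open>A\<close> and \<open>\<tau>\<close> is a non-scalar element of \<open>N\<close>, and it is a Pauli unitary because \<open>A\<close> is Clifford.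
If \<open>A\<close> commutes up to sign with all strings, then \<open>A\<close> is itself a multiple of a string
(\<open>commute_up_to_sign_pauli_strings_imp_string\<close>). The reason is that the Pauli strings span all
matrices: hence the trace of \<open>A * \<tau>\<close> is non-zero for some string \<open>\<tau>\<close>, a matrix with non-zero
trace that commutes up to sign with an involution commutes with it, and a matrix that commutes
with all strings is scalar.

The second step is that Clifford conjugation moves any non-scalar string to any other
(\<open>clifford_transitive_on_strings\<close>), so that \<open>N\<close> contains all strings. For two
anticommuting strings \<open>\<sigma>\<close> and \<open>\<tau>\<close> the matrix \<open>(\<sigma> + \<tau>) / sqrt 2\<close> is a Clifford
unitary exchanging them; it acts on the Pauli group modulo phases as a symplectic transvection. Two
arbitrary non-scalar strings are joined through a third one that anticommutes with both.

For the matrix representation, a unitary acting trivially by conjugation commutes with every matrix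
and is therefore scalar, that is, a global phase.\<close>

section \<open>The Kronecker product\<close>

lemma kron_carrier [intro, simp]:
  assumes "A \<in> carrier_mat a b" "B \<in> carrier_mat c d"
  shows "kron A B \<in> carrier_mat (a * c) (b * d)"
  using assms by (auto simp: kron_def)

lemma kron_index:
  assumes "A \<in> carrier_mat a b" "B \<in> carrier_mat c d" "i < a * c" "j < b * d"
  shows "kron A B $$ (i, j) = A $$ (i div c, j div d) * B $$ (i mod c, j mod d)"
  using assms by (auto simp: kron_def)

lemma div_mod_less:
  fixes i m c :: nat
  assumes "i < m * c"
  shows "i div c < m" "i mod c < c"
proof -
  have "0 < c" using assms by (cases c) auto
  then show "i div c < m" "i mod c < c" using assms by (auto simp: less_mult_imp_div_less)
qed

text \<open>The row index of a Kronecker product runs over \<open>m * c\<close> values that encode a pair; this turns a sum over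
such an index into the double sum needed for the mixed-product rule.\<close>

lemma sum_div_mod:
  fixes f :: "nat \<Rightarrow> nat \<Rightarrow> complex"
  shows "(\<Sum>k = 0..<m * c. f (k div c) (k mod c)) = (\<Sum>x = 0..<m. \<Sum>y = 0..<c. f x y)"
proof -
  have less: "x * c + y < m * c" if "x < m" "y < c" for x y
  proof -
    have "x * c + y < Suc x * c" using that by simp
    also have "\<dots> \<le> m * c" using that by (intro mult_le_mono1) auto
    finally show ?thesis .
  qed
  have "(\<Sum>x = 0..<m. \<Sum>y = 0..<c. f x y) = (\<Sum>(x, y) \<in> {0..<m} \<times> {0..<c}. f x y)"
    by (simp add: sum.cartesian_product)
  also have "\<dots> = (\<Sum>k = 0..<m * c. f (k div c) (k mod c))"
    by (rule sum.reindex_bij_witness[where i = "\<lambda>k. (k div c, k mod c)" and j = "\<lambda>(x, y). x * c + y"])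
      (auto simp: less dest: div_mod_less)
  finally show ?thesis by simp
qed

lemma kron_mult_kron:
  assumes A: "A \<in> carrier_mat a b" and B: "B \<in> carrier_mat c d"
    and C: "C \<in> carrier_mat b e" and D: "D \<in> carrier_mat d f"
  shows "kron A B * kron C D = kron (A * C) (B * D)"
proof (rule eq_matI)
  fix i j assume "i < dim_row (kron (A * C) (B * D))" "j < dim_col (kron (A * C) (B * D))"
  then have ij: "i < a * c" "j < e * f" using A B C D by (auto simp: kron_def)
  note lt = div_mod_less[OF ij(1)] div_mod_less[OF ij(2)]
  have "(kron A B * kron C D) $$ (i, j) = (\<Sum>k = 0..<b * d. kron A B $$ (i, k) * kron C D $$ (k, j))"
    using ij kron_carrier[OF A B] kron_carrier[OF C D] by (simp add: scalar_prod_def)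
  also have "\<dots> = (\<Sum>k = 0..<b * d. (A $$ (i div c, k div d) * B $$ (i mod c, k mod d))
      * (C $$ (k div d, j div f) * D $$ (k mod d, j mod f)))"
    using ij by (intro sum.cong) (auto simp: kron_index[OF A B] kron_index[OF C D])
  also have "\<dots> = (\<Sum>x = 0..<b. \<Sum>y = 0..<d. (A $$ (i div c, x) * B $$ (i mod c, y))
      * (C $$ (x, j div f) * D $$ (y, j mod f)))"
    by (rule sum_div_mod)
  also have "\<dots> = (\<Sum>x = 0..<b. A $$ (i div c, x) * C $$ (x, j div f))
      * (\<Sum>y = 0..<d. B $$ (i mod c, y) * D $$ (y, j mod f))"
    by (simp add: sum_product mult_ac)
  also have "\<dots> = kron (A * C) (B * D) $$ (i, j)"
    using A B C D ij lt
    by (simp add: kron_index[OF mult_carrier_mat[OF A C] mult_carrier_mat[OF B D]] scalar_prod_def)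
  finally show "(kron A B * kron C D) $$ (i, j) = kron (A * C) (B * D) $$ (i, j)" .
qed (use A B C D in \<open>simp_all add: kron_def\<close>)

lemma kron_smult_left: "kron (c \<cdot>\<^sub>m A) B = c \<cdot>\<^sub>m kron A B"
  by (rule eq_matI) (auto simp: kron_def div_mod_less)

lemma kron_smult_right: "kron A (c \<cdot>\<^sub>m B) = c \<cdot>\<^sub>m kron A B"
  by (rule eq_matI) (auto simp: kron_def div_mod_less)

lemma kron_add_right:
  assumes "dim_row B = dim_row C" "dim_col B = dim_col C"
  shows "kron A (B + C) = kron A B + kron A C"
  using assms by (intro eq_matI) (auto simp: kron_def simp: div_mod_less algebra_simps)

lemma mat_adjoint_kron: "mat_adjoint (kron A B) = kron (mat_adjoint A) (mat_adjoint B)"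
  by (rule eq_matI) (auto simp: kron_def mat_adjoint_index div_mod_less)

lemma kron_one: "kron (1\<^sub>m a) (1\<^sub>m b) = 1\<^sub>m (a * b)"
proof (rule eq_matI)
  fix i j assume "i < dim_row (1\<^sub>m (a * b) :: complex mat)" "j < dim_col (1\<^sub>m (a * b) :: complex mat)"
  then have ij: "i < a * b" "j < a * b" by auto
  have "i = j \<longleftrightarrow> i div b = j div b \<and> i mod b = j mod b"
    by (metis div_mult_mod_eq)
  then show "kron (1\<^sub>m a) (1\<^sub>m b) $$ (i, j) = 1\<^sub>m (a * b) $$ (i, j)"
    using ij div_mod_less[OF ij(1)] div_mod_less[OF ij(2)]
    by (auto simp: kron_index[of _ a a _ b b])
qed (auto simp: kron_def)

section \<open>Pauli strings\<close>

definition single_qubit_paulis :: "complex mat set" where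
  "single_qubit_paulis = {1\<^sub>m 2, pauli_X, pauli_Y, pauli_Z}"

lemma pauli_strings_0: "pauli_strings 0 = {1\<^sub>m 1}"
  by (auto simp: pauli_strings_def)

lemma pauli_strings_Suc:
  "pauli_strings (Suc n) = {kron a \<sigma> | a \<sigma>. a \<in> single_qubit_paulis \<and> \<sigma> \<in> pauli_strings n}" (is "?L = ?R")
proof
  show "?L \<subseteq> ?R"
    by (fastforce simp: pauli_strings_def single_qubit_paulis_def length_Suc_conv)
  show "?R \<subseteq> ?L"
  proof
    fix x assume "x \<in> ?R"
    then obtain a \<sigma>s where "x = foldr kron (a # \<sigma>s) (1\<^sub>m 1)" "length (a # \<sigma>s) = Suc n"
      "set (a # \<sigma>s) \<subseteq> single_qubit_paulis"
      by (auto simp: pauli_strings_def single_qubit_paulis_def)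
    then show "x \<in> ?L"
      unfolding pauli_strings_def single_qubit_paulis_def by blast
  qed
qed

lemma finite_pauli_strings: "finite (pauli_strings n)"
  by (induction n) (auto simp: pauli_strings_0 pauli_strings_Suc single_qubit_paulis_def
      intro: finite_image_set2)

lemma one_mem_pauli_strings: "1\<^sub>m (2 ^ n) \<in> pauli_strings n"
proof (induction n)
  case (Suc n)
  have "kron (1\<^sub>m 2) (1\<^sub>m (2 ^ n)) \<in> pauli_strings (Suc n)"
    using Suc by (auto simp: pauli_strings_Suc single_qubit_paulis_def)
  then show ?case by (simp add: kron_one)
qed (simp add: pauli_strings_0)

lemma less_2_nat: "(i :: nat) < 2 \<longleftrightarrow> i = 0 \<or> i = 1"
  by auto

lemmas pauli_defs = pauli_X_def pauli_Y_def pauli_Z_def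

lemma single_qubit_pauli_carrier: "a \<in> single_qubit_paulis \<Longrightarrow> a \<in> carrier_mat 2 2"
  by (auto simp: single_qubit_paulis_def pauli_defs mat_of_rows_list_def)

lemma single_qubit_pauli_adjoint: "a \<in> single_qubit_paulis \<Longrightarrow> mat_adjoint a = a"
  by (auto simp: single_qubit_paulis_def pauli_defs mat_of_rows_list_def mat_adjoint_one
      mat_adjoint_index numeral_2_eq_2 less_Suc_eq intro!: eq_matI)

lemma single_qubit_pauli_square: "a \<in> single_qubit_paulis \<Longrightarrow> a * a = 1\<^sub>m 2"
  by (auto simp: single_qubit_paulis_def pauli_defs mat_of_rows_list_def
      scalar_prod_def numeral_2_eq_2 less_Suc_eq intro!: eq_matI)

definition commute_up_to_sign :: "complex mat \<Rightarrow> complex mat \<Rightarrow> bool" where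
  "commute_up_to_sign A B \<longleftrightarrow> (\<exists>s \<in> {1, - 1}. A * B = s \<cdot>\<^sub>m (B * A))"

lemma single_qubit_paulis_commute:
  assumes "a \<in> single_qubit_paulis" "b \<in> single_qubit_paulis"
  shows "commute_up_to_sign a b"
proof -
  \<comment> \<open>The unordered pairs keep the case analysis to the three pairs of distinct non-identity matrices.\<close>
  have neg: "X * Y = (- 1) \<cdot>\<^sub>m (Y * X)"
    if "{X, Y} \<in> {{pauli_X, pauli_Y}, {pauli_X, pauli_Z}, {pauli_Y, pauli_Z}}" for X Y
    using that by (auto simp: doubleton_eq_iff pauli_defs mat_of_rows_list_def
      scalar_prod_def numeral_2_eq_2 less_Suc_eq intro!: eq_matI)
  have "a * b = b * a \<or> {a, b} \<in> {{pauli_X, pauli_Y}, {pauli_X, pauli_Z}, {pauli_Y, pauli_Z}}"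
    using assms single_qubit_pauli_carrier[OF assms(1)] single_qubit_pauli_carrier[OF assms(2)]
    unfolding single_qubit_paulis_def by auto
  then show ?thesis
    using neg unfolding commute_up_to_sign_def by (auto simp: one_smult_mat)
qed

lemma pauli_string_carrier: "\<sigma> \<in> pauli_strings n \<Longrightarrow> \<sigma> \<in> carrier_mat (2 ^ n) (2 ^ n)"
  by (induction n arbitrary: \<sigma>)
    (auto simp: pauli_strings_0 pauli_strings_Suc dest: single_qubit_pauli_carrier)

lemma pauli_string_adjoint: "\<sigma> \<in> pauli_strings n \<Longrightarrow> mat_adjoint \<sigma> = \<sigma>"
  by (induction n arbitrary: \<sigma>)
    (auto simp: pauli_strings_0 pauli_strings_Suc mat_adjoint_one mat_adjoint_kron
      single_qubit_pauli_adjoint)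

lemma kron_pauli_mult:
  assumes "a \<in> single_qubit_paulis" "\<sigma> \<in> pauli_strings n" "b \<in> single_qubit_paulis" "\<tau> \<in> pauli_strings n"
  shows "kron a \<sigma> * kron b \<tau> = kron (a * b) (\<sigma> * \<tau>)"
  by (rule kron_mult_kron[OF assms(1)[THEN single_qubit_pauli_carrier] assms(2)[THEN pauli_string_carrier]
        assms(3)[THEN single_qubit_pauli_carrier] assms(4)[THEN pauli_string_carrier]])

lemma pauli_string_square: "\<sigma> \<in> pauli_strings n \<Longrightarrow> \<sigma> * \<sigma> = 1\<^sub>m (2 ^ n)"
  by (induction n arbitrary: \<sigma>)
    (auto simp: pauli_strings_0 pauli_strings_Suc kron_pauli_mult single_qubit_pauli_square
      kron_one)

lemma pauli_strings_commute:
  "\<sigma> \<in> pauli_strings n \<Longrightarrow> \<tau> \<in> pauli_strings n \<Longrightarrow> commute_up_to_sign \<sigma> \<tau>"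
proof (induction n arbitrary: \<sigma> \<tau>)
  case 0
  then show ?case by (auto simp: pauli_strings_0 commute_up_to_sign_def one_smult_mat)
next
  case (Suc n)
  then obtain a \<sigma>' b \<tau>' where *: "\<sigma> = kron a \<sigma>'" "\<tau> = kron b \<tau>'"
    "a \<in> single_qubit_paulis" "b \<in> single_qubit_paulis" "\<sigma>' \<in> pauli_strings n" "\<tau>' \<in> pauli_strings n"
    by (auto simp: pauli_strings_Suc)
  obtain s where s: "s \<in> {1, - 1}" "a * b = s \<cdot>\<^sub>m (b * a)"
    using single_qubit_paulis_commute[of a b] * by (auto simp: commute_up_to_sign_def)
  obtain t where t: "t \<in> {1, - 1}" "\<sigma>' * \<tau>' = t \<cdot>\<^sub>m (\<tau>' * \<sigma>')"
    using Suc.IH[of \<sigma>' \<tau>'] * by (auto simp: commute_up_to_sign_def)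
  have "\<sigma> * \<tau> = (s * t) \<cdot>\<^sub>m (\<tau> * \<sigma>)"
    unfolding *(1,2) kron_pauli_mult[OF *(3,5,4,6)] kron_pauli_mult[OF *(4,6,3,5)] s(2) t(2)
    by (simp add: kron_smult_left kron_smult_right smult_smult_mat_mult mult.commute)
  then show ?case using s(1) t(1) unfolding commute_up_to_sign_def by (intro bexI[of _ "s * t"]) auto
qed

text \<open>The Pauli strings span the space of all matrices, phrased as an induction rule so that linear
statements about arbitrary matrices reduce to strings. For one more qubit, a matrix is split into four
blocks, and the block structure is expanded in the basis of the four single-qubit matrices.\<close>

lemma pauli_strings_span_induct:
  assumes M: "M \<in> carrier_mat (2 ^ n) (2 ^ n)"
    and string: "\<And>\<sigma>. \<sigma> \<in> pauli_strings n \<Longrightarrow> P \<sigma>"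
    and add: "\<And>A B. A \<in> carrier_mat (2 ^ n) (2 ^ n) \<Longrightarrow> B \<in> carrier_mat (2 ^ n) (2 ^ n)
      \<Longrightarrow> P A \<Longrightarrow> P B \<Longrightarrow> P (A + B)"
    and smult: "\<And>c A. A \<in> carrier_mat (2 ^ n) (2 ^ n) \<Longrightarrow> P A \<Longrightarrow> P (c \<cdot>\<^sub>m A)"
  shows "P M"
  using assms
proof (induction n arbitrary: P M)
  case 0
  have "M = (M $$ (0, 0)) \<cdot>\<^sub>m 1\<^sub>m 1" using "0.prems"(1) by (intro eq_matI) auto
  moreover have "P ((M $$ (0, 0)) \<cdot>\<^sub>m 1\<^sub>m 1)"
    using "0.prems"(2,4) by (simp add: pauli_strings_0)
  ultimately show ?case by metis
next
  case (Suc n)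
  let ?d = "2 ^ n :: nat"
  have kron: "P (kron a N)" if a: "a \<in> single_qubit_paulis" and N: "N \<in> carrier_mat ?d ?d" for a N
    using N
  proof (rule Suc.IH)
    note carr = kron_carrier[OF single_qubit_pauli_carrier[OF a]]
    show "P (kron a \<sigma>)" if "\<sigma> \<in> pauli_strings n" for \<sigma>
      using that a by (intro Suc.prems(2)) (auto simp: pauli_strings_Suc)
    show "P (kron a (A + B))" if "A \<in> carrier_mat ?d ?d" "B \<in> carrier_mat ?d ?d"
      "P (kron a A)" "P (kron a B)" for A B
      using that carr[of A] carr[of B] by (subst kron_add_right) (auto intro!: Suc.prems(3))
    show "P (kron a (c \<cdot>\<^sub>m A))" if "A \<in> carrier_mat ?d ?d" "P (kron a A)" for c A
      using that carr[of A] by (auto simp: kron_smult_right intro!: Suc.prems(4))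
  qed
  \<comment> \<open>\<open>B x y\<close> are the blocks of \<open>M\<close>; with \<open>p, q, r, s\<close> their entries, solving \<open>p = WI + WZ\<close>,
    \<open>s = WI - WZ\<close>, \<open>q = WX - \<i> * WY\<close>, \<open>r = WX + \<i> * WY\<close> gives the formulas below.\<close>
  define B where "B x y = mat ?d ?d (\<lambda>(i, j). M $$ (x * ?d + i, y * ?d + j))" for x y :: nat
  define W where "W f = mat ?d ?d (\<lambda>(i, j). (f (B 0 0 $$ (i, j)) (B 0 1 $$ (i, j)) (B 1 0 $$ (i, j)) (B 1 1 $$ (i, j))) :: complex)" for f
  define WI where "WI = W (\<lambda>p q r s. (p + s) / 2)"
  define WX where "WX = W (\<lambda>p q r s. (q + r) / 2)"
  define WY where "WY = W (\<lambda>p q r s. \<i> * (q - r) / 2)"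
  define WZ where "WZ = W (\<lambda>p q r s. (p - s) / 2)"
  have W: "W f \<in> carrier_mat ?d ?d" for f by (simp add: W_def)
  have decomp: "M = kron (1\<^sub>m 2) WI + (kron pauli_X WX + (kron pauli_Y WY + kron pauli_Z WZ))"
  proof (rule eq_matI)
    fix i j assume "i < dim_row (kron (1\<^sub>m 2) WI + (kron pauli_X WX + (kron pauli_Y WY + kron pauli_Z WZ)))"
      "j < dim_col (kron (1\<^sub>m 2) WI + (kron pauli_X WX + (kron pauli_Y WY + kron pauli_Z WZ)))"
    then have ij: "i < 2 * ?d" "j < 2 * ?d"
      by (auto simp: kron_def WZ_def W_def pauli_defs mat_of_rows_list_def)
    obtain x k where x: "i = x * ?d + k" "k < ?d" "x = 0 \<or> x = 1"
      using div_mod_less[OF ij(1)] by (metis div_mult_mod_eq less_2_nat)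
    obtain y l where y: "j = y * ?d + l" "l < ?d" "y = 0 \<or> y = 1"
      using div_mod_less[OF ij(2)] by (metis div_mult_mod_eq less_2_nat)
    have Bxy: "M $$ (i, j) = B x y $$ (k, l)" using x y by (simp add: B_def)
    show "M $$ (i, j) = (kron (1\<^sub>m 2) WI + (kron pauli_X WX + (kron pauli_Y WY + kron pauli_Z WZ))) $$ (i, j)"
      unfolding Bxy using x(2,3) y(2,3) ij
      by (auto simp: x(1) y(1) kron_def WI_def WX_def WY_def WZ_def W_def pauli_defs mat_of_rows_list_def
          field_simps)
  qed (use Suc.prems(1) in \<open>auto simp: kron_def WZ_def W_def pauli_defs mat_of_rows_list_def\<close>)
  have paulis: "1\<^sub>m 2 \<in> single_qubit_paulis" "pauli_X \<in> single_qubit_paulis"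
    "pauli_Y \<in> single_qubit_paulis" "pauli_Z \<in> single_qubit_paulis"
    by (auto simp: single_qubit_paulis_def)
  note carr = paulis[THEN single_qubit_pauli_carrier, THEN kron_carrier, OF W]
  have "P (kron (1\<^sub>m 2) WI + (kron pauli_X WX + (kron pauli_Y WY + kron pauli_Z WZ)))"
    unfolding WI_def WX_def WY_def WZ_def
    by (intro Suc.prems(3) kron paulis W) (use carr in auto)
  then show ?case using decomp by simp
qed

section \<open>Matrices that commute with Pauli strings\<close>

text \<open>With all dimensions equal to \<open>d\<close>, no intermediate dimension has to be inferred when a nested product of
square matrices is normalised.\<close>

lemmas square_mat_simps = assoc_mult_mat[of _ d d _ d _ d] mult_smult_distrib[of _ d d _ d]
  mult_smult_assoc_mat[of _ d d _ d] mult_carrier_mat[of _ d d _ d] smult_carrier_mat[of _ d d]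
  add_carrier_mat[of _ d d] for d

definition mat_trace :: "complex mat \<Rightarrow> complex" where
  "mat_trace A = (\<Sum>i = 0..<dim_row A. A $$ (i, i))"

lemma mat_trace_mult:
  assumes "A \<in> carrier_mat d d" "B \<in> carrier_mat d d"
  shows "mat_trace (A * B) = (\<Sum>i = 0..<d. \<Sum>k = 0..<d. A $$ (i, k) * B $$ (k, i))"
  using assms by (auto simp: mat_trace_def scalar_prod_def)

lemma mat_trace_commute:
  assumes "A \<in> carrier_mat d d" "B \<in> carrier_mat d d"
  shows "mat_trace (A * B) = mat_trace (B * A)"
  unfolding mat_trace_mult[OF assms] mat_trace_mult[OF assms(2,1)]
  by (subst sum.swap) (simp add: mult.commute)

lemma mat_trace_add:
  "A \<in> carrier_mat d d \<Longrightarrow> B \<in> carrier_mat d d \<Longrightarrow> mat_trace (A + B) = mat_trace A + mat_trace B"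
  by (auto simp: mat_trace_def sum.distrib)

lemma mat_trace_smult: "A \<in> carrier_mat d d \<Longrightarrow> mat_trace (c \<cdot>\<^sub>m A) = c * mat_trace A"
  by (auto simp: mat_trace_def sum_distrib_left)

text \<open>The trace in question is the squared Frobenius norm.\<close>

lemma mat_trace_mult_adjoint_eq_0:
  assumes A: "A \<in> carrier_mat d d" and tr: "mat_trace (A * mat_adjoint A) = 0"
  shows "A = 0\<^sub>m d d"
proof -
  have "mat_trace (A * mat_adjoint A)
      = complex_of_real (\<Sum>i = 0..<d. \<Sum>k = 0..<d. (cmod (A $$ (i, k)))\<^sup>2)"
    using A by (simp add: mat_trace_mult[OF A mat_adjoint_carrier[OF A]] mat_adjoint_index
        flip: complex_norm_square)
  with tr have "(\<Sum>i = 0..<d. \<Sum>k = 0..<d. (cmod (A $$ (i, k)))\<^sup>2) = 0"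
    by (simp only: of_real_eq_0_iff)
  then have "\<forall>i < d. \<forall>k < d. A $$ (i, k) = 0"
    by (simp add: sum_nonneg_eq_0_iff sum_nonneg)
  then show ?thesis using A by (intro eq_matI) auto
qed

text \<open>The trace pairing is non-degenerate and the strings span, so a non-zero matrix cannot be
orthogonal to all strings.\<close>

lemma exists_pauli_string_trace_nonzero:
  assumes A: "A \<in> carrier_mat (2 ^ n) (2 ^ n)" and "A \<noteq> 0\<^sub>m (2 ^ n) (2 ^ n)"
  shows "\<exists>\<tau> \<in> pauli_strings n. mat_trace (A * \<tau>) \<noteq> 0"
proof (rule ccontr)
  let ?d = "2 ^ n :: nat"
  assume "\<not> ?thesis"
  then have 0: "mat_trace (A * \<tau>) = 0" if "\<tau> \<in> pauli_strings n" for \<tau> using that by auto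
  have "mat_trace (A * M) = 0" if "M \<in> carrier_mat ?d ?d" for M
    using that
  proof (rule pauli_strings_span_induct)
    fix B C assume BC: "B \<in> carrier_mat ?d ?d" "C \<in> carrier_mat ?d ?d"
      "mat_trace (A * B) = 0" "mat_trace (A * C) = 0"
    then show "mat_trace (A * (B + C)) = 0"
      using A by (simp add: mult_add_distrib_mat[OF A] mat_trace_add[of _ ?d])
  next
    fix c B assume "B \<in> carrier_mat ?d ?d" "mat_trace (A * B) = 0"
    then show "mat_trace (A * (c \<cdot>\<^sub>m B)) = 0"
      using A by (simp add: mult_smult_distrib[OF A] mat_trace_smult[of _ ?d])
  qed (rule 0)
  from this[OF mat_adjoint_carrier[OF A]] mat_trace_mult_adjoint_eq_0[OF A] assms(2)
  show False by simp
qed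

lemma commuting_with_all_imp_scalar:
  fixes B :: "complex mat"
  assumes B: "B \<in> carrier_mat d d"
    and comm: "\<And>M. M \<in> carrier_mat d d \<Longrightarrow> B * M = M * B"
  shows "\<exists>c. B = c \<cdot>\<^sub>m 1\<^sub>m d"
proof (intro exI eq_matI)
  fix i j assume "i < dim_row (B $$ (0, 0) \<cdot>\<^sub>m 1\<^sub>m d)" "j < dim_col (B $$ (0, 0) \<cdot>\<^sub>m 1\<^sub>m d)"
  then have ij: "i < d" "j < d" by auto
  \<comment> \<open>Compare the entries at \<open>(i, 0)\<close> of the products with the matrix unit at \<open>(j, 0)\<close>.\<close>
  let ?E = "mat d d (\<lambda>(k, l). if k = j \<and> l = 0 then 1 else 0) :: complex mat"
  have "(B * ?E) $$ (i, 0) = (\<Sum>k = 0..<d. B $$ (i, k) * (if k = j then 1 else 0))"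
    using B ij by (simp add: scalar_prod_def)
  then have 1: "(B * ?E) $$ (i, 0) = B $$ (i, j)"
    using ij by (simp add: if_distrib[of "(*) _"] cong: if_cong)
  have "(?E * B) $$ (i, 0) = (\<Sum>k = 0..<d. (if i = j \<and> k = 0 then 1 else 0) * B $$ (k, 0))"
    using B ij by (simp add: scalar_prod_def)
  also have "\<dots> = (\<Sum>k = 0..<d. if k = 0 then (if i = j then B $$ (0, 0) else 0) else 0)"
    by (intro sum.cong) auto
  finally have "(?E * B) $$ (i, 0) = (if i = j then B $$ (0, 0) else 0)"
    using ij by simp
  with 1 comm[of ?E] ij show "B $$ (i, j) = (B $$ (0, 0) \<cdot>\<^sub>m 1\<^sub>m d) $$ (i, j)" by auto
qed (use B in auto)

lemma commuting_with_pauli_strings_imp_scalar: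
  assumes B: "B \<in> carrier_mat (2 ^ n) (2 ^ n)"
    and comm: "\<And>\<sigma>. \<sigma> \<in> pauli_strings n \<Longrightarrow> B * \<sigma> = \<sigma> * B"
  shows "\<exists>c. B = c \<cdot>\<^sub>m 1\<^sub>m (2 ^ n)"
proof (rule commuting_with_all_imp_scalar[OF B])
  let ?d = "2 ^ n :: nat"
  fix M :: "complex mat" assume "M \<in> carrier_mat ?d ?d"
  then show "B * M = M * B"
  proof (rule pauli_strings_span_induct)
    fix C D assume "C \<in> carrier_mat ?d ?d" "D \<in> carrier_mat ?d ?d" "B * C = C * B" "B * D = D * B"
    then show "B * (C + D) = (C + D) * B"
      using B by (simp add: mult_add_distrib_mat[OF B] add_mult_distrib_mat[of _ ?d ?d])
  next
    fix c C assume "C \<in> carrier_mat ?d ?d" "B * C = C * B"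
    then show "B * (c \<cdot>\<^sub>m C) = (c \<cdot>\<^sub>m C) * B"
      using B by (simp add: mult_smult_distrib[OF B] mult_smult_assoc_mat[of _ ?d ?d])
  qed (rule comm)
qed

lemma commute_up_to_sign_mult:
  assumes A: "A \<in> carrier_mat d d" and B: "B \<in> carrier_mat d d" and C: "C \<in> carrier_mat d d"
    and "commute_up_to_sign A C" "commute_up_to_sign B C"
  shows "commute_up_to_sign (A * B) C"
proof -
  obtain s t where s: "s \<in> {1, - 1}" "A * C = s \<cdot>\<^sub>m (C * A)" and t: "t \<in> {1, - 1}" "B * C = t \<cdot>\<^sub>m (C * B)"
    using assms(4,5) by (auto simp: commute_up_to_sign_def)
  have "A * B * C = t \<cdot>\<^sub>m (A * C * B)"
    using A B C by (simp add: t(2) square_mat_simps[where d = d] smult_smult_mat_mult)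
  also have "\<dots> = (t * s) \<cdot>\<^sub>m (C * (A * B))"
    unfolding s(2) using A B C by (simp add: square_mat_simps[where d = d] smult_smult_mat_mult)
  finally show ?thesis
    using s(1) t(1) unfolding commute_up_to_sign_def by (intro bexI[of _ "t * s"]) auto
qed

text \<open>A character of the Pauli group is always realised by conjugation with a Pauli string; this is the
corresponding statement for matrices. Choose \<open>\<tau>\<close> with \<open>A * \<tau>\<close> of non-zero trace. Conjugating
\<open>A * \<tau>\<close> by a string multiplies it by a sign but preserves its trace, so the sign is \<open>1\<close>. Thus
\<open>A * \<tau>\<close> commutes with all strings and is scalar, and \<open>\<tau>\<close> is an involution.\<close>

lemma commute_up_to_sign_pauli_strings_imp_string:
  assumes A: "A \<in> carrier_mat (2 ^ n) (2 ^ n)" and nz: "A \<noteq> 0\<^sub>m (2 ^ n) (2 ^ n)"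
    and comm: "\<And>\<sigma>. \<sigma> \<in> pauli_strings n \<Longrightarrow> commute_up_to_sign A \<sigma>"
  shows "\<exists>\<tau> \<in> pauli_strings n. \<exists>c. A = c \<cdot>\<^sub>m \<tau>"
proof -
  let ?d = "2 ^ n :: nat"
  obtain \<tau> where \<tau>: "\<tau> \<in> pauli_strings n" and tr: "mat_trace (A * \<tau>) \<noteq> 0"
    using exists_pauli_string_trace_nonzero[OF A nz] by blast
  note \<tau>c = pauli_string_carrier[OF \<tau>]
  define B where "B = A * \<tau>"
  have B: "B \<in> carrier_mat ?d ?d" using A \<tau>c by (simp add: B_def)
  have "B * \<sigma> = \<sigma> * B" if \<sigma>: "\<sigma> \<in> pauli_strings n" for \<sigma>
  proof -
    note \<sigma>c = pauli_string_carrier[OF \<sigma>]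
    obtain s where s: "B * \<sigma> = s \<cdot>\<^sub>m (\<sigma> * B)"
      using commute_up_to_sign_mult[OF A \<tau>c \<sigma>c comm[OF \<sigma>] pauli_strings_commute[OF \<tau> \<sigma>]]
      unfolding commute_up_to_sign_def B_def by blast
    have "mat_trace B = mat_trace (B * \<sigma> * \<sigma>)"
      using B \<sigma>c pauli_string_square[OF \<sigma>] by simp
    also have "\<dots> = s * mat_trace ((\<sigma> * B) * \<sigma>)"
      unfolding s using B \<sigma>c
      by (simp add: square_mat_simps[where d = ?d] smult_smult_mat_mult mat_trace_smult[of _ ?d])
    also have "mat_trace ((\<sigma> * B) * \<sigma>) = mat_trace (\<sigma> * (\<sigma> * B))"
      using B \<sigma>c by (intro mat_trace_commute) auto
    also have "\<sigma> * (\<sigma> * B) = B"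
      using B \<sigma>c pauli_string_square[OF \<sigma>] by (simp flip: assoc_mult_mat[of _ ?d ?d _ ?d _ ?d])
    finally have "s = 1" using tr by (simp add: B_def)
    then show ?thesis using s by (simp add: one_smult_mat)
  qed
  then obtain c where c: "A * \<tau> = c \<cdot>\<^sub>m 1\<^sub>m ?d"
    using commuting_with_pauli_strings_imp_scalar[OF B] unfolding B_def by blast
  have "A = A * \<tau> * \<tau>" using A \<tau>c pauli_string_square[OF \<tau>] by simp
  also have "\<dots> = c \<cdot>\<^sub>m \<tau>" unfolding c using \<tau>c by (simp add: mult_smult_assoc_mat[of _ ?d ?d])
  finally show ?thesis using \<tau> by blast
qed

lemma pauli_string_nonzero: "\<sigma> \<in> pauli_strings n \<Longrightarrow> c \<noteq> 0 \<Longrightarrow> c \<cdot>\<^sub>m \<sigma> \<noteq> 0\<^sub>m (2 ^ n) (2 ^ n)"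
proof
  let ?d = "2 ^ n :: nat"
  assume \<sigma>: "\<sigma> \<in> pauli_strings n" and c: "c \<noteq> 0" and "c \<cdot>\<^sub>m \<sigma> = 0\<^sub>m ?d ?d"
  then have "(c \<cdot>\<^sub>m \<sigma>) * \<sigma> = 0\<^sub>m ?d ?d" using pauli_string_carrier[OF \<sigma>] by simp
  then have "c \<cdot>\<^sub>m 1\<^sub>m ?d = 0\<^sub>m ?d ?d"
    using pauli_string_carrier[OF \<sigma>] pauli_string_square[OF \<sigma>]
    by (simp add: mult_smult_assoc_mat[of _ ?d ?d])
  then have "(c \<cdot>\<^sub>m 1\<^sub>m ?d) $$ (0, 0) = (0\<^sub>m ?d ?d :: complex mat) $$ (0, 0)" by simp
  then show False using c by simp
qed

lemma smult_one_mat_cancel: "c \<cdot>\<^sub>m 1\<^sub>m (2 ^ n) = e \<cdot>\<^sub>m 1\<^sub>m (2 ^ n) \<longleftrightarrow> c = (e :: complex)"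
proof
  assume "c \<cdot>\<^sub>m 1\<^sub>m (2 ^ n) = e \<cdot>\<^sub>m (1\<^sub>m (2 ^ n) :: complex mat)"
  then have "(c \<cdot>\<^sub>m 1\<^sub>m (2 ^ n)) $$ (0, 0) = (e \<cdot>\<^sub>m (1\<^sub>m (2 ^ n) :: complex mat)) $$ (0, 0)" by simp
  then show "c = e" by simp
qed simp

text \<open>A product of strings commutes up to sign with every string, so it is a multiple of a string by the preceding
characterisation. The bound on the phase comes from squaring: the square of \<open>\<sigma> * \<tau>\<close> is \<open>1\<close> or \<open>- 1\<close>,
and that of \<open>\<omega>\<close> is \<open>1\<close>.\<close>

lemma pauli_strings_mult:
  assumes \<sigma>: "\<sigma> \<in> pauli_strings n" and \<tau>: "\<tau> \<in> pauli_strings n"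
  shows "\<exists>\<omega> \<in> pauli_strings n. \<exists>c. c ^ 4 = 1 \<and> \<sigma> * \<tau> = c \<cdot>\<^sub>m \<omega>"
proof -
  let ?d = "2 ^ n :: nat"
  note cc = pauli_string_carrier[OF \<sigma>] pauli_string_carrier[OF \<tau>]
  obtain s where s: "s \<in> {1, - 1}" "\<tau> * \<sigma> = s \<cdot>\<^sub>m (\<sigma> * \<tau>)"
    using pauli_strings_commute[OF \<tau> \<sigma>] by (auto simp: commute_up_to_sign_def)
  have "(\<sigma> * \<tau>) * (\<sigma> * \<tau>) = \<sigma> * (\<tau> * \<sigma>) * \<tau>" using cc by (simp add: square_mat_simps[where d = ?d] smult_smult_mat_mult)
  also have "\<dots> = s \<cdot>\<^sub>m ((\<sigma> * \<sigma>) * (\<tau> * \<tau>))"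
    unfolding s(2) using cc by (simp add: square_mat_simps[where d = ?d] smult_smult_mat_mult)
  finally have sq: "(\<sigma> * \<tau>) * (\<sigma> * \<tau>) = s \<cdot>\<^sub>m 1\<^sub>m ?d"
    by (simp add: pauli_string_square[OF \<sigma>] pauli_string_square[OF \<tau>])
  have nz: "\<sigma> * \<tau> \<noteq> 0\<^sub>m ?d ?d"
    using sq s(1) pauli_string_nonzero[OF one_mem_pauli_strings, of s n] by auto
  obtain \<omega> c where \<omega>: "\<omega> \<in> pauli_strings n" and c: "\<sigma> * \<tau> = c \<cdot>\<^sub>m \<omega>"
    using commute_up_to_sign_pauli_strings_imp_string[OF mult_carrier_mat[OF cc] nz]
      commute_up_to_sign_mult[OF cc pauli_string_carrier] pauli_strings_commute \<sigma> \<tau> by metis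
  have "s \<cdot>\<^sub>m 1\<^sub>m ?d = c\<^sup>2 \<cdot>\<^sub>m (\<omega> * \<omega>)"
    using sq pauli_string_carrier[OF \<omega>] unfolding c
    by (simp add: mult_smult_assoc_mat[of _ ?d ?d] mult_smult_distrib[of _ ?d ?d]
        smult_smult_mat_mult power2_eq_square)
  then have "c\<^sup>2 = s" using pauli_string_square[OF \<omega>] by (simp add: smult_one_mat_cancel)
  then have "c ^ 4 = 1" using s(1) by (auto simp: power4_eq_xxxx power2_eq_square)
  with \<omega> c show ?thesis by blast
qed

section \<open>Pauli unitaries and Clifford unitaries\<close>

abbreviation unitary_inv :: "nat \<Rightarrow> complex mat \<Rightarrow> complex mat" where
  "unitary_inv n A \<equiv> inv\<^bsub>unitary_group (2 ^ n)\<^esub> A"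

lemma unitary_group_simps [simp]:
  "monoid.mult (unitary_group d) = (*)" "one (unitary_group d) = 1\<^sub>m d"
  by (simp_all add: unitary_group_def)

lemma unitary_carrier_mat: "A \<in> carrier (unitary_group d) \<Longrightarrow> A \<in> carrier_mat d d"
  by (simp add: unitary_group_def)

lemma smult_mem_unitary_group:
  assumes A: "A \<in> carrier (unitary_group d)" and c: "c * cnj c = 1"
  shows "c \<cdot>\<^sub>m A \<in> carrier (unitary_group d)"
  using A c by (auto simp: unitary_group_def mat_adjoint_smult square_mat_simps[where d = d]
      smult_smult_mat_mult one_smult_mat mult.commute[of "cnj c"])

lemma unimodular_if_smult_mem_unitary_group:
  assumes A: "A \<in> carrier (unitary_group (2 ^ n))" and cA: "c \<cdot>\<^sub>m A \<in> carrier (unitary_group (2 ^ n))"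
  shows "c * cnj c = 1"
proof -
  let ?d = "2 ^ n :: nat"
  have "(c \<cdot>\<^sub>m A) * mat_adjoint (c \<cdot>\<^sub>m A) = (c * cnj c) \<cdot>\<^sub>m (A * mat_adjoint A)"
    using unitary_carrier_mat[OF A]
    by (simp add: mat_adjoint_smult square_mat_simps[where d = ?d] smult_smult_mat_mult mult.commute)
  then have "(c * cnj c) \<cdot>\<^sub>m 1\<^sub>m ?d = 1 \<cdot>\<^sub>m 1\<^sub>m ?d"
    using A cA by (simp add: unitary_group_def one_smult_mat)
  then show ?thesis by (simp only: smult_one_mat_cancel)
qed

lemma pauli_string_mem_unitary_group: "\<sigma> \<in> pauli_strings n \<Longrightarrow> \<sigma> \<in> carrier (unitary_group (2 ^ n))"
  by (simp add: unitary_group_def pauli_string_carrier pauli_string_adjoint pauli_string_square)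

lemma inv_pauli_string: "\<sigma> \<in> pauli_strings n \<Longrightarrow> unitary_inv n \<sigma> = \<sigma>"
  by (simp add: inv_unitary_group pauli_string_mem_unitary_group pauli_string_adjoint)

lemma subgroup_pauli_unitaries: "subgroup (pauli_unitaries n) (unitary_group (2 ^ n))"
  unfolding pauli_unitaries_def
  by (intro group.generate_is_subgroup group_unitary_group) (auto intro: pauli_string_mem_unitary_group)

lemma pauli_string_mem_pauli_unitaries: "\<sigma> \<in> pauli_strings n \<Longrightarrow> \<sigma> \<in> pauli_unitaries n"
  unfolding pauli_unitaries_def by (rule generate.incl)

lemma pauli_unitaries_mult:
  "A \<in> pauli_unitaries n \<Longrightarrow> B \<in> pauli_unitaries n \<Longrightarrow> A * B \<in> pauli_unitaries n"
  using subgroup.m_closed[OF subgroup_pauli_unitaries] by simp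

lemma pauli_unitary_eq_smult_string:
  assumes "g \<in> pauli_unitaries n"
  shows "\<exists>\<sigma> \<in> pauli_strings n. \<exists>c. c ^ 4 = 1 \<and> g = c \<cdot>\<^sub>m \<sigma>"
  using assms unfolding pauli_unitaries_def
proof (induction g rule: generate.induct)
  case one
  then show ?case
    by (intro bexI[OF _ one_mem_pauli_strings] exI[of _ 1]) (simp add: one_smult_mat)
next
  case (incl h)
  then show ?case by (intro bexI[of _ h] exI[of _ 1]) (simp_all add: one_smult_mat)
next
  case (inv h)
  then show ?case by (intro bexI[of _ h] exI[of _ 1]) (simp_all add: one_smult_mat inv_pauli_string)
next
  case (eng g h)
  let ?d = "2 ^ n :: nat"
  obtain \<sigma> c \<tau> e where *: "\<sigma> \<in> pauli_strings n" "c ^ 4 = 1" "g = c \<cdot>\<^sub>m \<sigma>"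
    "\<tau> \<in> pauli_strings n" "e ^ 4 = 1" "h = e \<cdot>\<^sub>m \<tau>" using eng.IH by blast
  obtain \<omega> f where \<omega>: "\<omega> \<in> pauli_strings n" "f ^ 4 = 1" "\<sigma> * \<tau> = f \<cdot>\<^sub>m \<omega>"
    using pauli_strings_mult[OF *(1,4)] by blast
  have "g * h = (c * e * f) \<cdot>\<^sub>m \<omega>"
    using *(1,4)[THEN pauli_string_carrier] \<omega>(3)
    by (simp add: *(3,6) square_mat_simps[where d = ?d] smult_smult_mat_mult mult_ac)
  moreover have "(c * e * f) ^ 4 = 1" using * \<omega> by (simp add: power_mult_distrib)
  ultimately show ?case using \<omega>(1) by auto
qed

text \<open>Finiteness is what makes the Clifford unitaries closed under inverses: they are defined by mapping the Pauli
unitaries into themselves, and an injective self-map of a finite set is onto.\<close>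

lemma finite_pauli_unitaries: "finite (pauli_unitaries n)"
proof (rule finite_subset)
  show "pauli_unitaries n \<subseteq> (\<lambda>(c, \<sigma>). c \<cdot>\<^sub>m \<sigma>) ` ({c. c ^ 4 = 1} \<times> pauli_strings n)"
    using pauli_unitary_eq_smult_string by fastforce
  show "finite ((\<lambda>(c, \<sigma>). c \<cdot>\<^sub>m \<sigma>) ` ({c :: complex. c ^ 4 = 1} \<times> pauli_strings n))"
    using finite_roots_unity[of 4] by (intro finite_imageI finite_cartesian_product finite_pauli_strings) auto
qed

lemma subgroup_finite_normalizer:
  assumes "group G" and K: "subgroup K G" and fin: "finite K"
  shows "subgroup {a \<in> carrier G. \<forall>k \<in> K. a \<otimes>\<^bsub>G\<^esub> k \<otimes>\<^bsub>G\<^esub> inv\<^bsub>G\<^esub> a \<in> K} G"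
proof -
  interpret group G by fact
  have Kc: "k \<in> carrier G" if "k \<in> K" for k using subgroup.mem_carrier[OF K that] .
  have conj_mult: "a \<otimes>\<^bsub>G\<^esub> b \<otimes>\<^bsub>G\<^esub> k \<otimes>\<^bsub>G\<^esub> inv\<^bsub>G\<^esub> (a \<otimes>\<^bsub>G\<^esub> b) = a \<otimes>\<^bsub>G\<^esub> (b \<otimes>\<^bsub>G\<^esub> k \<otimes>\<^bsub>G\<^esub> inv\<^bsub>G\<^esub> b) \<otimes>\<^bsub>G\<^esub> inv\<^bsub>G\<^esub> a"
    if "a \<in> carrier G" "b \<in> carrier G" "k \<in> K" for a b k
    using that Kc by (simp add: m_assoc inv_mult_group)
  show ?thesis
  proof (rule subgroupI)
    fix a assume "a \<in> {a \<in> carrier G. \<forall>k \<in> K. a \<otimes>\<^bsub>G\<^esub> k \<otimes>\<^bsub>G\<^esub> inv\<^bsub>G\<^esub> a \<in> K}"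
    then have a: "a \<in> carrier G" "\<And>k. k \<in> K \<Longrightarrow> a \<otimes>\<^bsub>G\<^esub> k \<otimes>\<^bsub>G\<^esub> inv\<^bsub>G\<^esub> a \<in> K" by auto
    have inj: "inj_on (\<lambda>k. a \<otimes>\<^bsub>G\<^esub> k \<otimes>\<^bsub>G\<^esub> inv\<^bsub>G\<^esub> a) K"
      using a Kc by (intro inj_onI) simp
    have surj: "(\<lambda>k. a \<otimes>\<^bsub>G\<^esub> k \<otimes>\<^bsub>G\<^esub> inv\<^bsub>G\<^esub> a) ` K = K"
      using a(2) by (intro endo_inj_surj[OF fin _ inj]) auto
    have "inv\<^bsub>G\<^esub> a \<otimes>\<^bsub>G\<^esub> k \<otimes>\<^bsub>G\<^esub> inv\<^bsub>G\<^esub> (inv\<^bsub>G\<^esub> a) \<in> K" if "k \<in> K" for k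
    proof -
      have "k \<in> (\<lambda>k. a \<otimes>\<^bsub>G\<^esub> k \<otimes>\<^bsub>G\<^esub> inv\<^bsub>G\<^esub> a) ` K" unfolding surj by (rule that)
      then obtain l where l: "l \<in> K" "k = a \<otimes>\<^bsub>G\<^esub> l \<otimes>\<^bsub>G\<^esub> inv\<^bsub>G\<^esub> a" by (rule imageE)
      note c = a(1) inv_closed[OF a(1)] Kc[OF l(1)]
      have "inv\<^bsub>G\<^esub> a \<otimes>\<^bsub>G\<^esub> k \<otimes>\<^bsub>G\<^esub> a = (inv\<^bsub>G\<^esub> a \<otimes>\<^bsub>G\<^esub> a) \<otimes>\<^bsub>G\<^esub> l \<otimes>\<^bsub>G\<^esub> (inv\<^bsub>G\<^esub> a \<otimes>\<^bsub>G\<^esub> a)"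
        unfolding l(2) by (simp only: m_assoc m_closed c)
      then have "inv\<^bsub>G\<^esub> a \<otimes>\<^bsub>G\<^esub> k \<otimes>\<^bsub>G\<^esub> inv\<^bsub>G\<^esub> (inv\<^bsub>G\<^esub> a) = l" using c by simp
      then show ?thesis using l(1) by simp
    qed
    then show "inv\<^bsub>G\<^esub> a \<in> {a \<in> carrier G. \<forall>k \<in> K. a \<otimes>\<^bsub>G\<^esub> k \<otimes>\<^bsub>G\<^esub> inv\<^bsub>G\<^esub> a \<in> K}"
      using a(1) by simp
  next
    show "{a \<in> carrier G. \<forall>k \<in> K. a \<otimes>\<^bsub>G\<^esub> k \<otimes>\<^bsub>G\<^esub> inv\<^bsub>G\<^esub> a \<in> K} \<noteq> {}"
      using Kc by (auto intro!: exI[of _ "\<one>\<^bsub>G\<^esub>"])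
  qed (use conj_mult in auto)
qed

lemma subgroup_clifford_unitaries: "subgroup (carrier (clifford_unitaries n)) (unitary_group (2 ^ n))"
  using subgroup_finite_normalizer[OF group_unitary_group subgroup_pauli_unitaries finite_pauli_unitaries]
  by (simp add: clifford_unitaries_def)

lemma clifford_unitaries_simps [simp]:
  "monoid.mult (clifford_unitaries n) = (*)" "one (clifford_unitaries n) = 1\<^sub>m (2 ^ n)"
  by (simp_all add: clifford_unitaries_def)

lemma group_clifford_unitaries: "group (clifford_unitaries n)"
  using subgroup.subgroup_is_group[OF subgroup_clifford_unitaries group_unitary_group]
  by (simp add: clifford_unitaries_def)

lemma clifford_unitary_unitary: "A \<in> carrier (clifford_unitaries n) \<Longrightarrow> A \<in> carrier (unitary_group (2 ^ n))"
  by (simp add: clifford_unitaries_def)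

lemma inv_clifford_unitaries:
  "A \<in> carrier (clifford_unitaries n) \<Longrightarrow> inv\<^bsub>clifford_unitaries n\<^esub> A = unitary_inv n A"
  using group.m_inv_consistent[OF group_unitary_group subgroup_clifford_unitaries, of A n]
  by (simp add: clifford_unitaries_def)

lemma clifford_conj_pauli:
  "A \<in> carrier (clifford_unitaries n) \<Longrightarrow> g \<in> pauli_unitaries n \<Longrightarrow> A * g * unitary_inv n A \<in> pauli_unitaries n"
  by (simp add: clifford_unitaries_def)

lemma pauli_unitary_clifford:
  assumes g: "g \<in> pauli_unitaries n"
  shows "g \<in> carrier (clifford_unitaries n)"
  using g subgroup.m_closed[OF subgroup_pauli_unitaries, of _ n] subgroup.m_inv_closed[OF subgroup_pauli_unitaries, of _ n]
    subgroup.mem_carrier[OF subgroup_pauli_unitaries, of _ n]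
  by (auto simp: clifford_unitaries_def)

text \<open>It suffices to test the defining condition on the generators, and the form \<open>W * \<rho> = g * W\<close> avoids computing inverses.\<close>

lemma clifford_unitaryI:
  assumes W: "W \<in> carrier (unitary_group (2 ^ n))"
    and conj: "\<And>\<rho>. \<rho> \<in> pauli_strings n \<Longrightarrow> \<exists>g \<in> pauli_unitaries n. W * \<rho> = g * W"
  shows "W \<in> carrier (clifford_unitaries n)"
proof -
  let ?U = "unitary_group (2 ^ n)"
  interpret U: group ?U by (rule group_unitary_group)
  interpret P: subgroup "pauli_unitaries n" ?U by (rule subgroup_pauli_unitaries)
  have string: "W * \<rho> * unitary_inv n W \<in> pauli_unitaries n" if \<rho>: "\<rho> \<in> pauli_strings n" for \<rho>
  proof -
    obtain g where g: "g \<in> pauli_unitaries n" "W * \<rho> = g * W" using conj[OF \<rho>] by blast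
    have "W * \<rho> * unitary_inv n W = g"
      unfolding g(2) using U.m_assoc[of g W "unitary_inv n W"] U.r_inv[OF W] U.r_one[of g] W g(1) by simp
    then show ?thesis using g(1) by simp
  qed
  have "W * g * unitary_inv n W \<in> pauli_unitaries n" if "g \<in> pauli_unitaries n" for g
    using that unfolding pauli_unitaries_def
  proof (induction g rule: generate.induct)
    case one
    have "W * 1\<^sub>m (2 ^ n) * unitary_inv n W = 1\<^sub>m (2 ^ n)"
      using U.r_inv[OF W] U.r_one[OF W] by simp
    then show ?case using generate.one[of ?U] by simp
  next
    case (incl h)
    then show ?case using string unfolding pauli_unitaries_def by blast
  next
    case (inv h)
    then show ?case using string by (simp add: inv_pauli_string pauli_unitaries_def)
  next
    case (eng g h)
    have gh: "g \<in> carrier ?U" "h \<in> carrier ?U"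
      using eng.hyps P.mem_carrier unfolding pauli_unitaries_def by blast+
    note c = gh W U.inv_closed[OF W]
    have "(W * g * unitary_inv n W) * (W * h * unitary_inv n W) = W * g * (unitary_inv n W * W) * h * unitary_inv n W"
      using c[THEN unitary_carrier_mat] by (simp add: square_mat_simps[where d = "2 ^ n"])
    also have "\<dots> = W * (g * h) * unitary_inv n W"
      using U.l_inv[OF W] c[THEN unitary_carrier_mat] by (simp add: square_mat_simps[where d = "2 ^ n"])
    finally show ?case using generate.eng[OF eng.IH] by simp
  qed
  then show ?thesis using W by (simp add: clifford_unitaries_def)
qed

section \<open>Exchanging anticommuting Pauli strings\<close>

lemma mat_adjoint_add:
  "A \<in> carrier_mat d e \<Longrightarrow> B \<in> carrier_mat d e \<Longrightarrow>
    mat_adjoint (A + B) = mat_adjoint A + mat_adjoint (B :: complex mat)"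
  by (rule eq_matI) (auto simp: mat_adjoint_index)

definition anticommute :: "complex mat \<Rightarrow> complex mat \<Rightarrow> bool" where
  "anticommute A B \<longleftrightarrow> A * B = (- 1) \<cdot>\<^sub>m (B * A)"

lemma anticommute_sym: "anticommute A B \<Longrightarrow> anticommute B A"
  by (simp add: anticommute_def smult_smult_mat_mult one_smult_mat)

lemma commute_or_anticommute:
  "\<sigma> \<in> pauli_strings n \<Longrightarrow> \<tau> \<in> pauli_strings n \<Longrightarrow> \<sigma> * \<tau> = \<tau> * \<sigma> \<or> anticommute \<sigma> \<tau>"
  using pauli_strings_commute[of \<sigma> n \<tau>]
  by (auto simp: commute_up_to_sign_def anticommute_def one_smult_mat)

text \<open>If \<open>\<rho>\<close> commutes with \<open>\<sigma>\<close> and anticommutes with \<open>\<tau>\<close>, both sides equal \<open>\<rho> * (\<sigma> - \<tau>)\<close>. This is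
the case in which the transvection attached to \<open>\<sigma> * \<tau>\<close> moves \<open>\<rho>\<close>.\<close>

lemma anticommuting_sum_mult_string:
  assumes \<sigma>: "\<sigma> \<in> pauli_strings n" and \<tau>: "\<tau> \<in> pauli_strings n" and anti: "anticommute \<sigma> \<tau>"
    and \<rho>: "\<rho> \<in> pauli_strings n" and \<rho>\<sigma>: "\<sigma> * \<rho> = \<rho> * \<sigma>" and \<rho>\<tau>: "anticommute \<tau> \<rho>"
  shows "(\<sigma> + \<tau>) * \<rho> = (\<rho> * (\<sigma> * \<tau>)) * (\<sigma> + \<tau>)"
proof -
  let ?d = "2 ^ n :: nat"
  note c = \<sigma>[THEN pauli_string_carrier] \<tau>[THEN pauli_string_carrier] \<rho>[THEN pauli_string_carrier]
  have "(\<sigma> + \<tau>) * \<rho> = \<rho> * \<sigma> + (- 1) \<cdot>\<^sub>m (\<rho> * \<tau>)"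
    using \<rho>\<sigma> \<rho>\<tau> c by (simp add: anticommute_def add_mult_distrib_mat[of _ ?d ?d])
  moreover have "(\<sigma> * \<tau>) * \<sigma> = (- 1) \<cdot>\<^sub>m \<tau>"
  proof -
    have "(\<sigma> * \<tau>) * \<sigma> = (- 1) \<cdot>\<^sub>m (\<tau> * (\<sigma> * \<sigma>))"
      using anti c unfolding anticommute_def by (simp add: square_mat_simps[where d = ?d])
    then show ?thesis using pauli_string_square[OF \<sigma>] c by simp
  qed
  moreover have "(\<sigma> * \<tau>) * \<tau> = \<sigma>"
    using pauli_string_square[OF \<tau>] c by simp
  moreover have "(\<rho> * (\<sigma> * \<tau>)) * (\<sigma> + \<tau>) = \<rho> * ((\<sigma> * \<tau>) * \<sigma>) + \<rho> * ((\<sigma> * \<tau>) * \<tau>)"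
    using c by (simp add: square_mat_simps[where d = ?d] mult_add_distrib_mat[of _ ?d ?d])
  ultimately show ?thesis
    using c by (simp add: square_mat_simps[where d = ?d] comm_add_mat[of "\<rho> * \<sigma>" ?d ?d])
qed

text \<open>There are four cases, according to whether \<open>\<rho>\<close> commutes or anticommutes with \<open>\<sigma>\<close> and \<open>\<tau>\<close>. If it behaves in the
same way towards both, it commutes or anticommutes with the sum.\<close>

lemma anticommuting_sum_normalizes:
  assumes \<sigma>: "\<sigma> \<in> pauli_strings n" and \<tau>: "\<tau> \<in> pauli_strings n" and anti: "anticommute \<sigma> \<tau>"
    and \<rho>: "\<rho> \<in> pauli_strings n"
  shows "\<exists>g \<in> pauli_unitaries n. (\<sigma> + \<tau>) * \<rho> = g * (\<sigma> + \<tau>)"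
proof -
  let ?d = "2 ^ n :: nat"
  note c = \<sigma>[THEN pauli_string_carrier] \<tau>[THEN pauli_string_carrier] \<rho>[THEN pauli_string_carrier]
  note mem = \<sigma>[THEN pauli_string_mem_pauli_unitaries] \<tau>[THEN pauli_string_mem_pauli_unitaries]
    \<rho>[THEN pauli_string_mem_pauli_unitaries]
  consider "\<sigma> * \<rho> = \<rho> * \<sigma>" "\<tau> * \<rho> = \<rho> * \<tau>" | "\<sigma> * \<rho> = \<rho> * \<sigma>" "anticommute \<tau> \<rho>"
    | "anticommute \<sigma> \<rho>" "\<tau> * \<rho> = \<rho> * \<tau>" | "anticommute \<sigma> \<rho>" "anticommute \<tau> \<rho>"
    using commute_or_anticommute[OF \<sigma> \<rho>] commute_or_anticommute[OF \<tau> \<rho>] by blast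
  then show ?thesis
  proof cases
    case 1
    then have "(\<sigma> + \<tau>) * \<rho> = \<rho> * (\<sigma> + \<tau>)"
      using c by (simp add: add_mult_distrib_mat[of _ ?d ?d] mult_add_distrib_mat[of _ ?d ?d])
    then show ?thesis using mem(3) by blast
  next
    case 2
    then show ?thesis
      using anticommuting_sum_mult_string[OF \<sigma> \<tau> anti \<rho>] mem pauli_unitaries_mult by blast
  next
    case 3
    then have "(\<sigma> + \<tau>) * \<rho> = (\<rho> * (\<tau> * \<sigma>)) * (\<sigma> + \<tau>)"
      using anticommuting_sum_mult_string[OF \<tau> \<sigma> anticommute_sym[OF anti] \<rho>]
      by (simp add: comm_add_mat[OF c(1,2)])
    then show ?thesis using mem pauli_unitaries_mult by blast
  next
    case 4
    \<comment> \<open>The witness is \<open>- \<rho>\<close>, which is a Pauli unitary because it is a conjugate of \<open>\<rho>\<close>.\<close>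
    have "(\<sigma> * \<rho>) * \<sigma> = (- 1) \<cdot>\<^sub>m \<rho>"
    proof -
      have "(\<sigma> * \<rho>) * \<sigma> = (- 1) \<cdot>\<^sub>m (\<rho> * (\<sigma> * \<sigma>))"
        using 4(1) c unfolding anticommute_def by (simp add: square_mat_simps[where d = ?d])
      then show ?thesis using pauli_string_square[OF \<sigma>] c by simp
    qed
    moreover have "(\<sigma> + \<tau>) * \<rho> = (- 1) \<cdot>\<^sub>m \<rho> * (\<sigma> + \<tau>)"
      using 4 c unfolding anticommute_def
      by (simp add: square_mat_simps[where d = ?d] add_mult_distrib_mat[of _ ?d ?d]
          mult_add_distrib_mat[of _ ?d ?d])
    ultimately show ?thesis using mem pauli_unitaries_mult by metis
  qed
qed

text \<open>The witness is \<open>(\<sigma> + \<tau>) / sqrt 2\<close>. It is Hermitian, and since the mixed terms of its square cancel, it is a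
unitary involution; it exchanges \<open>\<sigma>\<close> and \<open>\<tau>\<close> because \<open>(\<sigma> + \<tau>) * \<sigma> = 1 + \<tau> * \<sigma> = \<tau> * (\<sigma> + \<tau>)\<close>.\<close>

lemma exists_clifford_swap:
  assumes \<sigma>: "\<sigma> \<in> pauli_strings n" and \<tau>: "\<tau> \<in> pauli_strings n" and anti: "anticommute \<sigma> \<tau>"
  shows "\<exists>W \<in> carrier (clifford_unitaries n). W * \<sigma> = \<tau> * W"
proof -
  let ?d = "2 ^ n :: nat"
  note c = \<sigma>[THEN pauli_string_carrier] \<tau>[THEN pauli_string_carrier]
  define r where "r = complex_of_real (1 / sqrt 2)"
  have "r * r = complex_of_real (1 / sqrt 2 * (1 / sqrt 2))" unfolding r_def by (rule of_real_mult[symmetric])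
  then have r: "cnj r = r" "r * (r * 2) = 1"
    by (simp_all add: r_def flip: mult.assoc)
  define W where "W = r \<cdot>\<^sub>m (\<sigma> + \<tau>)"
  have Wc: "W \<in> carrier_mat ?d ?d" using c by (simp add: W_def)
  have adj: "mat_adjoint W = W"
    using c by (simp add: W_def mat_adjoint_smult mat_adjoint_add[of _ ?d ?d] r pauli_string_adjoint[OF \<sigma>] pauli_string_adjoint[OF \<tau>])
  have "(\<sigma> + \<tau>) * (\<sigma> + \<tau>) = (1\<^sub>m ?d + (- 1) \<cdot>\<^sub>m (\<tau> * \<sigma>)) + (\<tau> * \<sigma> + 1\<^sub>m ?d)"
    using c anti pauli_string_square[OF \<sigma>] pauli_string_square[OF \<tau>] unfolding anticommute_def
    by (simp add: add_mult_distrib_mat[of _ ?d ?d] mult_add_distrib_mat[of _ ?d ?d]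
      assoc_add_mat[of _ ?d ?d] comm_add_mat[of "\<tau> * \<sigma>" ?d ?d])
  also have "\<dots> = 2 \<cdot>\<^sub>m 1\<^sub>m ?d"
    using c by (intro eq_matI) auto
  finally have "W * W = 1\<^sub>m ?d"
    using c by (simp add: W_def square_mat_simps[where d = ?d] smult_smult_mat_mult r one_smult_mat)
  then have "W \<in> carrier (unitary_group ?d)"
    using Wc by (simp add: unitary_group_def adj)
  moreover have "\<exists>g \<in> pauli_unitaries n. W * \<rho> = g * W" if \<rho>: "\<rho> \<in> pauli_strings n" for \<rho>
  proof -
    obtain g where g: "g \<in> pauli_unitaries n" "(\<sigma> + \<tau>) * \<rho> = g * (\<sigma> + \<tau>)"
      using anticommuting_sum_normalizes[OF \<sigma> \<tau> anti \<rho>] by blast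
    have gc: "g \<in> carrier_mat ?d ?d"
      using g(1) unitary_carrier_mat subgroup.mem_carrier[OF subgroup_pauli_unitaries] by blast
    have "W * \<rho> = r \<cdot>\<^sub>m ((\<sigma> + \<tau>) * \<rho>)"
      unfolding W_def using c pauli_string_carrier[OF \<rho>] by (intro mult_smult_assoc_mat) auto
    also have "\<dots> = g * W"
      unfolding W_def g(2) using c gc by (intro mult_smult_distrib[symmetric]) auto
    finally show ?thesis using g(1) by blast
  qed
  ultimately have "W \<in> carrier (clifford_unitaries n)" by (rule clifford_unitaryI)
  moreover have "(\<sigma> + \<tau>) * \<sigma> = \<tau> * (\<sigma> + \<tau>)"
    using c pauli_string_square[OF \<sigma>] pauli_string_square[OF \<tau>]
    by (simp add: add_mult_distrib_mat[of _ ?d ?d] mult_add_distrib_mat[of _ ?d ?d]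
      comm_add_mat[of "\<tau> * \<sigma>" ?d ?d])
  then have "W * \<sigma> = \<tau> * W"
    using c by (simp add: W_def square_mat_simps[where d = ?d])
  ultimately show ?thesis by blast
qed

section \<open>Transitivity of the Clifford group on Pauli strings\<close>

definition is_scalar_mat :: "complex mat \<Rightarrow> bool" where
  "is_scalar_mat A \<longleftrightarrow> (\<exists>c. A = c \<cdot>\<^sub>m 1\<^sub>m (dim_row A))"

lemma is_scalar_mat_iff: "A \<in> carrier_mat d d \<Longrightarrow> is_scalar_mat A \<longleftrightarrow> (\<exists>c. A = c \<cdot>\<^sub>m 1\<^sub>m d)"
  by (auto simp: is_scalar_mat_def)

text \<open>A string that commutes with all strings would be scalar.\<close>

lemma exists_anticommuting_string:
  assumes \<sigma>: "\<sigma> \<in> pauli_strings n" and "\<not> is_scalar_mat \<sigma>"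
  shows "\<exists>\<rho> \<in> pauli_strings n. anticommute \<rho> \<sigma>"
proof (rule ccontr)
  assume "\<not> ?thesis"
  then have "\<sigma> * \<rho> = \<rho> * \<sigma>" if "\<rho> \<in> pauli_strings n" for \<rho>
    using commute_or_anticommute[OF that \<sigma>] that by auto
  then show False
    using assms(2) commuting_with_pauli_strings_imp_scalar[OF pauli_string_carrier[OF \<sigma>]]
    by (simp add: is_scalar_mat_iff[OF pauli_string_carrier[OF \<sigma>]])
qed

lemma anticommute_mult:
  assumes "A \<in> carrier_mat d d" "B \<in> carrier_mat d d" "C \<in> carrier_mat d d"
    and "A * C = C * A \<and> anticommute B C \<or> anticommute A C \<and> B * C = C * B"
  shows "anticommute (A * B) C"
proof -
  obtain s t where st: "s * t = - 1" "A * C = s \<cdot>\<^sub>m (C * A)" "B * C = t \<cdot>\<^sub>m (C * B)"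
  proof (cases "A * C = C * A \<and> anticommute B C")
    case True
    then show ?thesis using that[of 1 "- 1"] by (simp add: anticommute_def one_smult_mat)
  next
    case False
    then show ?thesis using that[of "- 1" 1] assms(4) by (auto simp: anticommute_def one_smult_mat)
  qed
  have "A * B * C = t \<cdot>\<^sub>m (A * C * B)"
    using assms(1-3) by (simp add: st(3) square_mat_simps[where d = d])
  also have "\<dots> = (t * s) \<cdot>\<^sub>m (C * (A * B))"
    unfolding st(2) using assms(1-3) by (simp add: square_mat_simps[where d = d] smult_smult_mat_mult)
  finally show ?thesis using st(1) by (simp add: anticommute_def mult.commute)
qed

lemma anticommute_smultD:
  assumes A: "A \<in> carrier_mat d d" and B: "B \<in> carrier_mat d d" and c: "c \<noteq> 0"
    and anti: "anticommute (c \<cdot>\<^sub>m A) B"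
  shows "anticommute A B"
proof -
  have "c \<cdot>\<^sub>m (A * B) = c \<cdot>\<^sub>m ((- 1) \<cdot>\<^sub>m (B * A))"
    using anti A B by (simp add: anticommute_def square_mat_simps[where d = d] smult_smult_mat_mult)
  then have "(1 / c) \<cdot>\<^sub>m (c \<cdot>\<^sub>m (A * B)) = (1 / c) \<cdot>\<^sub>m (c \<cdot>\<^sub>m ((- 1) \<cdot>\<^sub>m (B * A)))" by simp
  then show ?thesis
    using c by (simp add: anticommute_def smult_smult_mat_mult one_smult_mat)
qed

text \<open>Let \<open>\<alpha>\<close> anticommute with \<open>\<sigma>\<close> and \<open>\<beta>\<close> with \<open>\<tau>\<close>. If neither anticommutes with both, then \<open>\<alpha>\<close> commutes with
\<open>\<tau>\<close> and \<open>\<beta>\<close> with \<open>\<sigma>\<close>, so the string proportional to \<open>\<alpha> * \<beta>\<close> anticommutes with both.\<close>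

lemma exists_common_anticommuting_string:
  assumes \<sigma>: "\<sigma> \<in> pauli_strings n" "\<not> is_scalar_mat \<sigma>" and \<tau>: "\<tau> \<in> pauli_strings n" "\<not> is_scalar_mat \<tau>"
  shows "\<exists>\<rho> \<in> pauli_strings n. anticommute \<rho> \<sigma> \<and> anticommute \<rho> \<tau>"
proof -
  obtain \<alpha> where \<alpha>: "\<alpha> \<in> pauli_strings n" "anticommute \<alpha> \<sigma>" using exists_anticommuting_string[OF \<sigma>] by blast
  obtain \<beta> where \<beta>: "\<beta> \<in> pauli_strings n" "anticommute \<beta> \<tau>" using exists_anticommuting_string[OF \<tau>] by blast
  show ?thesis
  proof (cases "anticommute \<alpha> \<tau> \<or> anticommute \<beta> \<sigma>")
    case True
    then show ?thesis using \<alpha> \<beta> by blast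
  next
    case False
    then have comm: "\<alpha> * \<tau> = \<tau> * \<alpha>" "\<beta> * \<sigma> = \<sigma> * \<beta>"
      using commute_or_anticommute \<alpha>(1) \<beta>(1) \<sigma>(1) \<tau>(1) by blast+
    note carr = \<alpha>(1)[THEN pauli_string_carrier] \<beta>(1)[THEN pauli_string_carrier]
      \<sigma>(1)[THEN pauli_string_carrier] \<tau>(1)[THEN pauli_string_carrier]
    obtain \<omega> c where \<omega>: "\<omega> \<in> pauli_strings n" "c ^ 4 = 1" "\<alpha> * \<beta> = c \<cdot>\<^sub>m \<omega>"
      using pauli_strings_mult[OF \<alpha>(1) \<beta>(1)] by blast
    have "c \<noteq> 0" using \<omega>(2) by auto
    moreover have "anticommute (c \<cdot>\<^sub>m \<omega>) \<sigma>" "anticommute (c \<cdot>\<^sub>m \<omega>) \<tau>"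
      using anticommute_mult[OF carr(1,2,3)] anticommute_mult[OF carr(1,2,4)] comm \<alpha>(2) \<beta>(2)
      unfolding \<omega>(3) by blast+
    ultimately have "anticommute \<omega> \<sigma>" "anticommute \<omega> \<tau>"
      using anticommute_smultD pauli_string_carrier[OF \<omega>(1)] carr by blast+
    then show ?thesis using \<omega>(1) by blast
  qed
qed

text \<open>Exchange \<open>\<sigma>\<close> with a string that anticommutes with both, and that string with \<open>\<tau>\<close>. Going through the third string in
all cases also covers \<open>\<sigma> = \<tau>\<close> and commuting pairs.\<close>

lemma clifford_transitive_on_strings:
  assumes \<sigma>: "\<sigma> \<in> pauli_strings n" "\<not> is_scalar_mat \<sigma>" and \<tau>: "\<tau> \<in> pauli_strings n" "\<not> is_scalar_mat \<tau>"
  shows "\<exists>W \<in> carrier (clifford_unitaries n). W * \<sigma> = \<tau> * W"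
proof -
  let ?d = "2 ^ n :: nat"
  interpret group "clifford_unitaries n" by (rule group_clifford_unitaries)
  obtain \<rho> where \<rho>: "\<rho> \<in> pauli_strings n" "anticommute \<rho> \<sigma>" "anticommute \<rho> \<tau>"
    using exists_common_anticommuting_string[OF assms] by blast
  obtain W1 where W1: "W1 \<in> carrier (clifford_unitaries n)" "W1 * \<sigma> = \<rho> * W1"
    using exists_clifford_swap[OF \<sigma>(1) \<rho>(1) anticommute_sym[OF \<rho>(2)]] by blast
  obtain W2 where W2: "W2 \<in> carrier (clifford_unitaries n)" "W2 * \<rho> = \<tau> * W2"
    using exists_clifford_swap[OF \<rho>(1) \<tau>(1) \<rho>(3)] by blast
  note c = \<sigma>(1)[THEN pauli_string_carrier] \<tau>(1)[THEN pauli_string_carrier] \<rho>(1)[THEN pauli_string_carrier]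
    W1(1)[THEN clifford_unitary_unitary, THEN unitary_carrier_mat]
    W2(1)[THEN clifford_unitary_unitary, THEN unitary_carrier_mat]
  have "W2 * W1 * \<sigma> = W2 * \<rho> * W1" using c by (simp add: W1(2))
  also have "\<dots> = \<tau> * (W2 * W1)" unfolding W2(2) using c by simp
  finally show ?thesis using m_closed[OF W2(1) W1(1)] by auto
qed

section \<open>Normal subgroups of the Clifford group\<close>

lemma scalar_unitaries_iff:
  "A \<in> scalar_unitaries n \<longleftrightarrow> A \<in> carrier (unitary_group (2 ^ n)) \<and> is_scalar_mat A"
  unfolding scalar_unitaries_def using is_scalar_mat_iff[OF unitary_carrier_mat] by auto

lemma scalar_unitary_eq:
  "A \<in> scalar_unitaries n \<Longrightarrow> \<exists>c. A = c \<cdot>\<^sub>m 1\<^sub>m (2 ^ n) \<and> c * cnj c = 1"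
proof -
  let ?d = "2 ^ n :: nat"
  assume "A \<in> scalar_unitaries n"
  then obtain c where A: "A \<in> carrier (unitary_group ?d)" "A = c \<cdot>\<^sub>m 1\<^sub>m ?d"
    by (auto simp: scalar_unitaries_def)
  have "1\<^sub>m ?d \<in> carrier (unitary_group ?d)"
    by (rule pauli_string_mem_unitary_group[OF one_mem_pauli_strings])
  then have "c * cnj c = 1" using unimodular_if_smult_mem_unitary_group A by metis
  then show ?thesis using A(2) by blast
qed

lemma smult_one_mem_scalar_unitaries:
  assumes "c * cnj c = 1"
  shows "c \<cdot>\<^sub>m 1\<^sub>m (2 ^ n) \<in> scalar_unitaries n"
  using smult_mem_unitary_group[OF pauli_string_mem_unitary_group[OF one_mem_pauli_strings] assms]
  by (auto simp: scalar_unitaries_def)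

lemma scalar_unitary_commutes:
  assumes "S \<in> scalar_unitaries n" "A \<in> carrier_mat (2 ^ n) (2 ^ n)"
  shows "S * A = A * S"
  using scalar_unitary_eq[OF assms(1)] assms(2)
  by (auto simp: mult_smult_assoc_mat[of _ "2 ^ n" "2 ^ n"] mult_smult_distrib[of _ "2 ^ n" "2 ^ n"])

lemma scalar_unitaries_clifford: "scalar_unitaries n \<subseteq> carrier (clifford_unitaries n)"
proof
  fix S assume S: "S \<in> scalar_unitaries n"
  show "S \<in> carrier (clifford_unitaries n)"
  proof (rule clifford_unitaryI)
    show "S \<in> carrier (unitary_group (2 ^ n))" using S by (simp add: scalar_unitaries_iff)
    fix \<rho> assume "\<rho> \<in> pauli_strings n"
    then show "\<exists>g \<in> pauli_unitaries n. S * \<rho> = g * S"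
      using scalar_unitary_commutes[OF S] pauli_string_carrier pauli_string_mem_pauli_unitaries by blast
  qed
qed

lemma normal_scalar_unitaries: "scalar_unitaries n \<lhd> clifford_unitaries n"
proof -
  let ?d = "2 ^ n :: nat" and ?C = "clifford_unitaries n"
  interpret C: group ?C by (rule group_clifford_unitaries)
  have mult: "S * T \<in> scalar_unitaries n" if ST: "S \<in> scalar_unitaries n" "T \<in> scalar_unitaries n" for S T
  proof -
    obtain c e where ce: "S = c \<cdot>\<^sub>m 1\<^sub>m ?d" "c * cnj c = 1" "T = e \<cdot>\<^sub>m 1\<^sub>m ?d" "e * cnj e = 1"
      using scalar_unitary_eq[OF ST(1)] scalar_unitary_eq[OF ST(2)] by blast
    have "S * T = (c * e) \<cdot>\<^sub>m 1\<^sub>m ?d"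
      by (simp add: ce square_mat_simps[where d = ?d] smult_smult_mat_mult mult.commute)
    moreover have "(c * e) * cnj (c * e) = (c * cnj c) * (e * cnj e)" by simp
    then have "(c * e) * cnj (c * e) = 1" using ce by simp
    ultimately show ?thesis using smult_one_mem_scalar_unitaries[of "c * e" n] by simp
  qed
  have inv: "inv\<^bsub>?C\<^esub> S \<in> scalar_unitaries n" if S: "S \<in> scalar_unitaries n" for S
  proof -
    obtain c where c: "S = c \<cdot>\<^sub>m 1\<^sub>m ?d" "c * cnj c = 1" using scalar_unitary_eq[OF S] by blast
    have "inv\<^bsub>?C\<^esub> S = cnj c \<cdot>\<^sub>m 1\<^sub>m ?d"
      using inv_clifford_unitaries[of S n] inv_unitary_group[of S ?d] S scalar_unitaries_clifford[of n]
      by (auto simp: scalar_unitaries_iff c(1) mat_adjoint_smult mat_adjoint_one)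
    then show ?thesis using smult_one_mem_scalar_unitaries[of "cnj c" n] c(2) by (simp add: mult.commute)
  qed
  have "1\<^sub>m ?d \<in> scalar_unitaries n"
    using smult_one_mem_scalar_unitaries[of 1 n] by (simp add: one_smult_mat)
  then have "subgroup (scalar_unitaries n) ?C"
    using mult inv scalar_unitaries_clifford by (intro C.subgroupI) auto
  moreover have "A \<otimes>\<^bsub>?C\<^esub> S \<otimes>\<^bsub>?C\<^esub> inv\<^bsub>?C\<^esub> A \<in> scalar_unitaries n"
    if A: "A \<in> carrier ?C" and S: "S \<in> scalar_unitaries n" for A S
  proof -
    have SC: "S \<in> carrier ?C" using S scalar_unitaries_clifford by blast
    have "A \<otimes>\<^bsub>?C\<^esub> S = S \<otimes>\<^bsub>?C\<^esub> A"
      using scalar_unitary_commutes[OF S] unitary_carrier_mat[OF clifford_unitary_unitary[OF A]] by simp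
    then have "A \<otimes>\<^bsub>?C\<^esub> S \<otimes>\<^bsub>?C\<^esub> inv\<^bsub>?C\<^esub> A = S"
      using C.m_assoc[OF SC A C.inv_closed[OF A]] C.r_inv[OF A] C.r_one[OF SC] by simp
    then show ?thesis using S by simp
  qed
  ultimately show ?thesis by (auto simp: C.normal_inv_iff)
qed

lemma fourth_root_unimodular:
  fixes c :: complex
  assumes "c ^ 4 = 1"
  shows "c * cnj c = 1"
proof -
  have "cmod c ^ 4 = 1 ^ 4" using assms by (simp flip: norm_power)
  then have "cmod c = 1" by (rule power_eq_imp_eq_base) auto
  then show ?thesis by (simp add: complex_norm_square[symmetric])
qed

text \<open>A non-scalar element of \<open>N\<close> yields a non-scalar Pauli string in \<open>N\<close>, either directly or as a
commutator; conjugation then yields all non-scalar strings, and the phases are in \<open>N\<close> by assumption.\<close>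

theorem clifford_normal_subgroup_dichotomy:
  assumes N: "N \<lhd> clifford_unitaries n" and scal: "scalar_unitaries n \<subseteq> N"
    and A: "A \<in> N" and Ans: "\<not> is_scalar_mat A"
  shows "pauli_unitaries n \<subseteq> N"
proof -
  let ?d = "2 ^ n :: nat" and ?C = "clifford_unitaries n"
  interpret C: group ?C by (rule group_clifford_unitaries)
  interpret N: normal N ?C by (rule N)
  note cliff_mat = clifford_unitary_unitary[THEN unitary_carrier_mat]
  have AC: "A \<in> carrier ?C" using A N.subset by blast
  note Ac = cliff_mat[OF AC]
  have smult: "c \<cdot>\<^sub>m B \<in> N" if "B \<in> N" "c * cnj c = 1" for B c
  proof -
    have "c \<cdot>\<^sub>m 1\<^sub>m ?d * B \<in> N"
      using N.m_closed[of "c \<cdot>\<^sub>m 1\<^sub>m ?d" B] smult_one_mem_scalar_unitaries[OF that(2)] scal that(1) by auto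
    moreover have "B \<in> carrier_mat ?d ?d" using that(1) N.subset cliff_mat by blast
    ultimately show ?thesis by (simp add: mult_smult_assoc_mat[of _ ?d ?d])
  qed
  have string_if_smult: "\<sigma> \<in> N" if \<sigma>: "\<sigma> \<in> pauli_strings n" and c: "c \<cdot>\<^sub>m \<sigma> \<in> N" for \<sigma> c
  proof -
    have "c * cnj c = 1"
      using unimodular_if_smult_mem_unitary_group[OF pauli_string_mem_unitary_group[OF \<sigma>]] c
        N.subset clifford_unitary_unitary by blast
    then have "cnj c \<cdot>\<^sub>m (c \<cdot>\<^sub>m \<sigma>) = \<sigma>" "cnj c * cnj (cnj c) = 1"
      by (simp_all add: smult_smult_mat_mult one_smult_mat mult.commute)
    then show ?thesis using smult[OF c] by metis
  qed
  have scalar_smult: "is_scalar_mat (c \<cdot>\<^sub>m B)" if "is_scalar_mat B" for c B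
    using that unfolding is_scalar_mat_def by (metis index_smult_mat(2) smult_smult_mat_mult)
  obtain \<sigma> where \<sigma>: "\<sigma> \<in> pauli_strings n" "\<sigma> \<in> N" "\<not> is_scalar_mat \<sigma>"
  proof (cases "\<forall>\<tau> \<in> pauli_strings n. commute_up_to_sign A \<tau>")
    case True
    have "A \<noteq> 0 \<cdot>\<^sub>m 1\<^sub>m ?d" using Ans by (auto simp: is_scalar_mat_def)
    moreover have "(0\<^sub>m ?d ?d :: complex mat) = 0 \<cdot>\<^sub>m 1\<^sub>m ?d" by (rule eq_matI) auto
    ultimately obtain \<sigma> c where "\<sigma> \<in> pauli_strings n" "A = c \<cdot>\<^sub>m \<sigma>"
      using commute_up_to_sign_pauli_strings_imp_string[OF Ac] True by metis
    then show ?thesis using that[of \<sigma>] string_if_smult A Ans scalar_smult by blast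
  next
    case False
    then obtain \<tau> where \<tau>: "\<tau> \<in> pauli_strings n" "\<not> commute_up_to_sign A \<tau>" by blast
    note \<tau>c = pauli_string_carrier[OF \<tau>(1)]
    have \<tau>P: "\<tau> \<in> pauli_unitaries n" by (rule pauli_string_mem_pauli_unitaries[OF \<tau>(1)])
    have \<tau>C: "\<tau> \<in> carrier ?C" by (rule pauli_unitary_clifford[OF \<tau>P])
    define A' where "A' = inv\<^bsub>?C\<^esub> A"
    have A'N: "A' \<in> N" using A by (simp add: A'_def)
    have A'c: "A' \<in> carrier_mat ?d ?d" using A'N N.subset cliff_mat by blast
    have A'A: "A' * A = 1\<^sub>m ?d" using C.l_inv[OF AC] by (simp add: A'_def)
    \<comment> \<open>\<open>h\<close> is the commutator of \<open>A\<close> and \<open>\<tau>\<close>, written with \<open>\<tau>\<close> in place of its inverse. Normality of \<open>N\<close> puts it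
      in \<open>N\<close>; the Clifford property of \<open>A\<close> makes it a Pauli unitary.\<close>
    define h where "h = A * (\<tau> * A' * \<tau>)"
    have inv\<tau>: "inv\<^bsub>?C\<^esub> \<tau> = \<tau>" using inv_clifford_unitaries[OF \<tau>C] inv_pauli_string[OF \<tau>(1)] by simp
    have hN: "h \<in> N"
      using N.inv_op_closed2[OF \<tau>C A'N] N.m_closed[OF A] by (simp add: inv\<tau> h_def)
    have hP: "h \<in> pauli_unitaries n"
      using pauli_unitaries_mult[OF clifford_conj_pauli[OF AC \<tau>P] \<tau>P] inv_clifford_unitaries[OF AC] Ac A'c \<tau>c
      by (simp add: h_def A'_def square_mat_simps[where d = ?d])
    have h: "h * \<tau> * A = A * \<tau>"
    proof -
      have "h * \<tau> * A = A * (\<tau> * (A' * ((\<tau> * \<tau>) * A)))"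
        using Ac A'c \<tau>c by (simp add: h_def square_mat_simps[where d = ?d])
      also have "\<dots> = A * \<tau>"
        using Ac \<tau>c A'A pauli_string_square[OF \<tau>(1)] by simp
      finally show ?thesis .
    qed
    have hns: "\<not> is_scalar_mat h"
    proof
      assume "is_scalar_mat h"
      moreover have "h \<in> carrier_mat ?d ?d" using Ac A'c \<tau>c by (simp add: h_def)
      ultimately obtain e where e: "h = e \<cdot>\<^sub>m 1\<^sub>m ?d" by (auto simp: is_scalar_mat_iff)
      \<comment> \<open>Moving \<open>A\<close> past \<open>\<tau> * \<tau> = 1\<close> shows \<open>e * e = 1\<close>, against the choice of \<open>\<tau>\<close>.\<close>
      have comm: "A * \<tau> = e \<cdot>\<^sub>m (\<tau> * A)"
        using h Ac \<tau>c by (simp add: e square_mat_simps[where d = ?d])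
      have "A = A * \<tau> * \<tau>" using Ac \<tau>c pauli_string_square[OF \<tau>(1)] by simp
      also have "\<dots> = (e \<cdot>\<^sub>m (\<tau> * A)) * \<tau>" by (simp only: comm)
      also have "\<dots> = e \<cdot>\<^sub>m (\<tau> * (A * \<tau>))" using Ac \<tau>c by (simp add: square_mat_simps[where d = ?d])
      also have "\<dots> = (e * e) \<cdot>\<^sub>m ((\<tau> * \<tau>) * A)"
        unfolding comm using Ac \<tau>c by (simp add: square_mat_simps[where d = ?d] smult_smult_mat_mult)
      also have "\<dots> = (e * e) \<cdot>\<^sub>m A" using Ac pauli_string_square[OF \<tau>(1)] by simp
      finally have "A' * A = (e * e) \<cdot>\<^sub>m (A' * A)"
        using mult_smult_distrib[OF A'c Ac, of "e * e"] by metis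
      then have "1 \<cdot>\<^sub>m 1\<^sub>m ?d = (e * e) \<cdot>\<^sub>m 1\<^sub>m ?d" by (simp add: A'A one_smult_mat)
      then have "e * e = 1" by (simp only: smult_one_mat_cancel)
      then have "e \<in> {1, - 1}" by (simp add: square_eq_1_iff)
      then show False using comm \<tau>(2) unfolding commute_up_to_sign_def by blast
    qed
    obtain \<sigma> c where "\<sigma> \<in> pauli_strings n" "h = c \<cdot>\<^sub>m \<sigma>"
      using pauli_unitary_eq_smult_string[OF hP] by blast
    then show ?thesis using that[of \<sigma>] string_if_smult hN hns scalar_smult by blast
  qed
  have strings: "\<tau> \<in> N" if \<tau>: "\<tau> \<in> pauli_strings n" for \<tau>
  proof (cases "is_scalar_mat \<tau>")
    case True
    then show ?thesis using scal pauli_string_mem_unitary_group[OF \<tau>] by (auto simp: scalar_unitaries_iff)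
  next
    case False
    obtain W where W: "W \<in> carrier ?C" "W * \<sigma> = \<tau> * W"
      using clifford_transitive_on_strings[OF \<sigma>(1,3) \<tau> False] by blast
    have \<tau>C: "\<tau> \<in> carrier ?C" using pauli_unitary_clifford pauli_string_mem_pauli_unitaries \<tau> by blast
    have "W \<otimes>\<^bsub>?C\<^esub> \<sigma> \<otimes>\<^bsub>?C\<^esub> inv\<^bsub>?C\<^esub> W = \<tau> \<otimes>\<^bsub>?C\<^esub> W \<otimes>\<^bsub>?C\<^esub> inv\<^bsub>?C\<^esub> W" using W(2) by simp
    also have "\<dots> = \<tau>" using C.m_assoc[OF \<tau>C W(1) C.inv_closed[OF W(1)]] C.r_inv[OF W(1)] C.r_one[OF \<tau>C] by simp
    finally show ?thesis using N.inv_op_closed2[OF W(1) \<sigma>(2)] by simp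
  qed
  show ?thesis
  proof
    fix g assume "g \<in> pauli_unitaries n"
    then obtain \<tau> c where "\<tau> \<in> pauli_strings n" "c ^ 4 = 1" "g = c \<cdot>\<^sub>m \<tau>"
      using pauli_unitary_eq_smult_string by blast
    then show "g \<in> N" using strings smult fourth_root_unimodular by blast
  qed
qed

section \<open>Faithful representations\<close>

abbreviation phase_class :: "nat \<Rightarrow> complex mat \<Rightarrow> complex mat set" where
  "phase_class n A \<equiv> scalar_unitaries n #>\<^bsub>clifford_unitaries n\<^esub> A"

lemma phase_class_hom: "phase_class n \<in> hom (clifford_unitaries n) (clifford_group n)"
  unfolding clifford_group_def by (rule normal.r_coset_hom_Mod[OF normal_scalar_unitaries])

lemma group_clifford_group: "group (clifford_group n)"
  unfolding clifford_group_def by (rule normal.factorgroup_is_group[OF normal_scalar_unitaries])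

lemma carrier_clifford_group:
  "carrier (clifford_group n) = phase_class n ` carrier (clifford_unitaries n)"
  by (simp add: clifford_group_def carrier_FactGroup)

lemma one_clifford_group: "one (clifford_group n) = scalar_unitaries n"
  by (simp add: clifford_group_def)

lemma phase_class_scalar:
  assumes "A \<in> carrier (clifford_unitaries n)" "is_scalar_mat A"
  shows "phase_class n A = one (clifford_group n)"
proof -
  interpret group "clifford_unitaries n" by (rule group_clifford_unitaries)
  have "A \<in> scalar_unitaries n" using assms clifford_unitary_unitary by (simp add: scalar_unitaries_iff)
  then show ?thesis
    unfolding one_clifford_group
    by (rule coset_join2[OF assms(1) normal_imp_subgroup[OF normal_scalar_unitaries]])
qed

text \<open>The dichotomy is applied to the kernel of the action composed with the projection from the Clifford
unitaries. A Pauli element that moves a point rules out the second alternative, so this kernel is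
scalar, and scalar unitaries represent the identity of the Clifford group.\<close>

theorem faithful_if_pauli_nontrivial:
  assumes act: "group_action (clifford_group n) E \<rho>"
    and "\<exists>p \<in> pauli_group n. \<exists>v \<in> E. \<rho> p v \<noteq> v"
  shows "faithful_action (clifford_group n) E \<rho>"
proof -
  let ?C = "clifford_unitaries n"
  interpret group_action "clifford_group n" E \<rho> by (rule act)
  interpret \<rho>: group_hom "clifford_group n" "BijGroup E" \<rho> by (rule group_hom)
  interpret \<phi>: group_hom ?C "BijGroup E" "\<lambda>A. \<rho> (phase_class n A)"
    using hom_compose[OF phase_class_hom \<rho>.homh]
    by (intro group_hom.intro group_clifford_unitaries group_BijGroup group_hom_axioms.intro) (simp add: comp_def)
  define N where "N = kernel ?C (BijGroup E) (\<lambda>A. \<rho> (phase_class n A))"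
  have N: "N \<lhd> ?C" unfolding N_def by (rule \<phi>.normal_kernel)
  have scal: "scalar_unitaries n \<subseteq> N"
  proof
    fix S assume S: "S \<in> scalar_unitaries n"
    then have "phase_class n S = one (clifford_group n)"
      using subsetD[OF scalar_unitaries_clifford S] by (intro phase_class_scalar) (auto simp: scalar_unitaries_iff)
    then show "S \<in> N" using subsetD[OF scalar_unitaries_clifford S] by (auto simp: N_def kernel_def)
  qed
  obtain g v where g: "g \<in> pauli_unitaries n" "v \<in> E" "\<rho> (phase_class n g) v \<noteq> v"
    using assms(2) by (auto simp: pauli_group_def)
  have "g \<notin> N"
    using g(2,3) id_eq_one by (auto simp: N_def kernel_def BijGroup_def)
  then have ker: "is_scalar_mat A" if "A \<in> N" for A
    using clifford_normal_subgroup_dichotomy[OF N scal that] g(1) by blast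
  have "inj_on \<rho> (carrier (clifford_group n))"
  proof (subst \<rho>.inj_on_one_iff, intro allI impI)
    fix x assume x: "x \<in> carrier (clifford_group n)" "\<rho> x = \<one>\<^bsub>BijGroup E\<^esub>"
    then obtain A where A: "A \<in> carrier ?C" "x = phase_class n A" by (auto simp: carrier_clifford_group)
    then have "A \<in> N" using x(2) by (simp add: N_def kernel_def)
    then show "x = \<one>\<^bsub>clifford_group n\<^esub>" using phase_class_scalar[OF A(1) ker] A(2) by simp
  qed
  then show ?thesis by unfold_locales
qed

lemma conj_action_phase_class:
  assumes "A \<in> carrier (clifford_unitaries n)"
  shows "conj_action n (phase_class n A) = (\<lambda>M \<in> carrier_mat (2 ^ n) (2 ^ n). A * M * unitary_inv n A)"
proof
  fix M
  show "conj_action n (phase_class n A) M = (\<lambda>M \<in> carrier_mat (2 ^ n) (2 ^ n). A * M * unitary_inv n A) M"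
    using conj_action_coset[OF assms, of M]
    by (cases "M \<in> carrier_mat (2 ^ n) (2 ^ n)") (auto simp: conj_action_def module_mat_simps)
qed

lemma group_action_conj: "group_action (clifford_group n) (carrier_mat (2 ^ n) (2 ^ n)) (conj_action n)"
proof -
  let ?d = "2 ^ n :: nat" and ?C = "clifford_unitaries n"
  let ?E = "carrier_mat ?d ?d :: complex mat set"
  interpret C: group ?C by (rule group_clifford_unitaries)
  note cliff_mat = clifford_unitary_unitary[THEN unitary_carrier_mat]
  have conj: "conj_action n (phase_class n A) = (\<lambda>M \<in> ?E. A * M * inv\<^bsub>?C\<^esub> A)" if "A \<in> carrier ?C" for A
    using conj_action_phase_class[OF that] inv_clifford_unitaries[OF that] by simp
  have cancel: "inv\<^bsub>?C\<^esub> A * (A * M * inv\<^bsub>?C\<^esub> A) * A = M" "A * (inv\<^bsub>?C\<^esub> A * M * A) * inv\<^bsub>?C\<^esub> A = M"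
    "A * M * inv\<^bsub>?C\<^esub> A \<in> ?E" "inv\<^bsub>?C\<^esub> A * M * A \<in> ?E"
    if A: "A \<in> carrier ?C" and M: "M \<in> ?E" for A M
  proof -
    define A' where "A' = inv\<^bsub>?C\<^esub> A"
    have c: "A \<in> ?E" "A' \<in> ?E" using A cliff_mat unfolding A'_def by blast+
    have inv: "A * A' = 1\<^sub>m ?d" "A' * A = 1\<^sub>m ?d"
      using C.r_inv[OF A] C.l_inv[OF A] by (simp_all add: A'_def)
    have "A' * (A * M * A') * A = (A' * A) * M * (A' * A)" "A * (A' * M * A) * A' = (A * A') * M * (A * A')"
      using c M by (simp_all add: square_mat_simps[where d = ?d])
    then show "inv\<^bsub>?C\<^esub> A * (A * M * inv\<^bsub>?C\<^esub> A) * A = M" "A * (inv\<^bsub>?C\<^esub> A * M * A) * inv\<^bsub>?C\<^esub> A = M"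
      using M inv by (simp_all flip: A'_def)
    show "A * M * inv\<^bsub>?C\<^esub> A \<in> ?E" "inv\<^bsub>?C\<^esub> A * M * A \<in> ?E"
      using c M by (simp_all flip: A'_def)
  qed
  have Bij: "conj_action n (phase_class n A) \<in> Bij ?E" if A: "A \<in> carrier ?C" for A
  proof -
    have "bij_betw (\<lambda>M. A * M * inv\<^bsub>?C\<^esub> A) ?E ?E"
      using cancel[OF A] by (intro bij_betwI[where g = "\<lambda>M. inv\<^bsub>?C\<^esub> A * M * A"]) auto
    then show ?thesis by (auto simp: Bij_def conj[OF A] cong: bij_betw_cong)
  qed
  have mult: "conj_action n (phase_class n A \<otimes>\<^bsub>clifford_group n\<^esub> phase_class n B)
      = conj_action n (phase_class n A) \<otimes>\<^bsub>BijGroup ?E\<^esub> conj_action n (phase_class n B)"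
    if A: "A \<in> carrier ?C" and B: "B \<in> carrier ?C" for A B
  proof -
    have AB: "A * B \<in> carrier ?C" using C.m_closed[OF A B] by simp
    have "conj_action n (phase_class n A \<otimes>\<^bsub>clifford_group n\<^esub> phase_class n B) = conj_action n (phase_class n (A * B))"
      using hom_mult[OF phase_class_hom A B] by simp
    also have "\<dots> = (\<lambda>M \<in> ?E. A * B * M * inv\<^bsub>?C\<^esub> (A * B))" by (rule conj[OF AB])
    also have "\<dots> = (\<lambda>M \<in> ?E. A * (B * M * inv\<^bsub>?C\<^esub> B) * inv\<^bsub>?C\<^esub> A)"
    proof (rule restrict_ext)
      fix M assume M: "M \<in> ?E"
      note c = cliff_mat[OF A] cliff_mat[OF B] cliff_mat[OF C.inv_closed[OF A]] cliff_mat[OF C.inv_closed[OF B]]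
      show "A * B * M * inv\<^bsub>?C\<^esub> (A * B) = A * (B * M * inv\<^bsub>?C\<^esub> B) * inv\<^bsub>?C\<^esub> A"
        using C.inv_mult_group[OF A B] c M by (simp add: square_mat_simps[where d = ?d])
    qed
    also have "\<dots> = conj_action n (phase_class n A) \<otimes>\<^bsub>BijGroup ?E\<^esub> conj_action n (phase_class n B)"
      using Bij[OF A] Bij[OF B] cancel(3)[OF B]
      by (auto simp: BijGroup_def conj[OF A] conj[OF B] compose_def intro!: restrict_ext)
    finally show ?thesis .
  qed
  show ?thesis
    by (intro group_action.intro group_hom.intro group_clifford_group group_BijGroup group_hom_axioms.intro homI)
      (auto simp: carrier_clifford_group mult, use Bij in \<open>simp add: BijGroup_def\<close>)
qed

lemma representation_conj: "representation (clifford_group n) (matrix_space n) (conj_action n)"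
proof -
  let ?d = "2 ^ n :: nat" and ?R = "class_ring :: complex ring" and ?V = "matrix_space n"
  interpret V: vectorspace ?R ?V by (rule matrix_vs)
  interpret group_action "clifford_group n" "carrier ?V" "conj_action n"
    using group_action_conj by (simp add: module_mat_simps)
  show ?thesis
  proof (intro representation.intro representation_axioms.intro V.vectorspace_axioms group_action_axioms)
    fix x assume "x \<in> carrier (clifford_group n)"
    then obtain A where A: "A \<in> carrier (clifford_unitaries n)" "x = phase_class n A"
      by (auto simp: carrier_clifford_group)
    have c: "A \<in> carrier_mat ?d ?d" "unitary_inv n A \<in> carrier_mat ?d ?d"
      using clifford_unitary_unitary[OF A(1)] group.inv_closed[OF group_unitary_group] unitary_carrier_mat
      by blast+
    have "conj_action n x \<in> LinearCombinations.module_hom ?R ?V ?V"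
      using c by (auto simp: LinearCombinations.module_hom_def A(2) conj_action_phase_class[OF A(1)] module_mat_simps
          class_ring_simps add_mult_distrib_mat[of _ ?d ?d] mult_add_distrib_mat[of _ ?d ?d]
          mult_smult_assoc_mat[of _ ?d ?d] mult_smult_distrib[of _ ?d ?d])
    then show "linear_map ?R ?V ?V (conj_action n x)"
      by (simp add: linear_map_def mod_hom_def mod_hom_axioms_def V.vectorspace_axioms V.module_axioms)
  qed
qed

text \<open>A unitary that acts trivially by conjugation commutes with every matrix, hence is a global phase.\<close>

lemma faithful_conj: "faithful_action (clifford_group n) (carrier_mat (2 ^ n) (2 ^ n)) (conj_action n)"
proof -
  let ?d = "2 ^ n :: nat"
  interpret group_action "clifford_group n" "carrier_mat ?d ?d" "conj_action n" by (rule group_action_conj)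
  interpret conj: group_hom "clifford_group n" "BijGroup (carrier_mat ?d ?d)" "conj_action n" by (rule group_hom)
  have "inj_on (conj_action n) (carrier (clifford_group n))"
  proof (subst conj.inj_on_one_iff, intro allI impI)
    fix x assume x: "x \<in> carrier (clifford_group n)" "conj_action n x = \<one>\<^bsub>BijGroup (carrier_mat ?d ?d)\<^esub>"
    then obtain A where A: "A \<in> carrier (clifford_unitaries n)" "x = phase_class n A"
      by (auto simp: carrier_clifford_group)
    note AU = clifford_unitary_unitary[OF A(1)]
    note Ac = unitary_carrier_mat[OF AU]
    have Ai: "unitary_inv n A \<in> carrier_mat ?d ?d" "unitary_inv n A * A = 1\<^sub>m ?d"
      using group.inv_closed[OF group_unitary_group AU] unitary_carrier_mat
        group.l_inv[OF group_unitary_group AU] by auto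
    have "A * M = M * A" if M: "M \<in> carrier_mat ?d ?d" for M
    proof -
      have "A * M * unitary_inv n A = M"
        using fun_cong[OF x(2), of M] M by (simp add: A(2) conj_action_phase_class[OF A(1)] BijGroup_def)
      then have "M * A = A * M * unitary_inv n A * A" by simp
      also have "\<dots> = A * M" using Ac Ai M by (simp add: square_mat_simps[where d = ?d])
      finally show ?thesis by simp
    qed
    then have "is_scalar_mat A"
      using commuting_with_all_imp_scalar[OF Ac] by (simp add: is_scalar_mat_iff[OF Ac])
    then show "x = \<one>\<^bsub>clifford_group n\<^esub>" using phase_class_scalar[OF A(1)] A(2) by simp
  qed
  then show ?thesis by unfold_locales
qed

theorem corollary5p7:
  shows "(\<forall>n \<ge> 3. \<forall>(V :: (complex, 'v) module) \<rho>.
            representation (clifford_group n) V \<rho> \<longrightarrow>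
            (\<exists>p \<in> pauli_group n. \<exists>v \<in> carrier V. \<rho> p v \<noteq> v) \<longrightarrow>
            faithful_action (clifford_group n) (carrier V) \<rho>)
       \<and> (\<forall>n \<ge> 1. representation (clifford_group n) (matrix_space n) (conj_action n) \<and>
            faithful_action (clifford_group n) (carrier (matrix_space n)) (conj_action n))"
proof (intro conjI allI impI)
  fix n and V :: "(complex, 'v) module" and \<rho>
  assume "representation (clifford_group n) V \<rho>" "\<exists>p \<in> pauli_group n. \<exists>v \<in> carrier V. \<rho> p v \<noteq> v"
  then show "faithful_action (clifford_group n) (carrier V) \<rho>"
    by (intro faithful_if_pauli_nontrivial) (simp_all add: representation_def)
next
  fix n
  show "representation (clifford_group n) (matrix_space n) (conj_action n)" by (rule representation_conj)
  show "faithful_action (clifford_group n) (carrier (matrix_space n)) (conj_action n)"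
    using faithful_conj by (simp add: module_mat_simps)
qed

end
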